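(* Fix $z\in\mathbb{R}$ and $\gamma>0$. For $\alpha\neq0$ let $X(\alpha)$ be the Ornstein--Uhlenbeck bridge on $[0,1]$ with parameter $\alpha$, volatility $\gamma$ and terminal value $z$, driven by a common standard Brownian motion $B$ and started from a common point $x$ at time $0$; let $\widetilde X$ be the Brownian bridge on $[0,1]$ with volatility $\gamma$, driven by the same $B$, started at $x$, with $\widetilde X_1=z$. Let $V_\alpha,\beta_\alpha$ and $\widetilde V,\widetilde\beta$ be the corresponding value functions and optimal stopping boundaries. Then, as $\alpha\to0$: $X_t(\alpha)\to\widetilde X_t$ almost surely for all $t\in[0,1)$; $V_\alpha\to\widetilde V$ pointwise; and $\beta_\alpha\to\widetilde\beta$ pointwise.
   Context: $X(\alpha)$ solves $\mathrm{d}X_t=\alpha\frac{z-\cosh(\alpha(1-t))X_t}{\sinh(\alpha(1-t))}\,\mathrm{d}t+\gamma\,\mathrm{d}B_t$, with explicit representation, for $X_0=x$, $$X_t(\alpha)=x\frac{\sinh(\alpha(1-t))}{\sinh(\alpha)}+z\frac{\sinh(\alpha t)}{\sinh(\alpha)}+\gamma\int_0^t\frac{\sinh(\alpha(1-t))}{\sinh(\alpha(1-u))}\,\mathrm{d}B_u .$$ The Brownian bridge solves $\mathrm{d}\widetilde X_t=\frac{z-\widetilde X_t}{1-t}\,\mathrm{d}t+\gamma\,\mathrm{d}B_t$. For each of these processes $Z$ on $[0,1]$, the value function is $\sup_{\tau\leq1-t}\mathbb{E}[Z_{t+\tau}\mid Z_t=x]$ (supremum over random times $\tau\in[0,1-t]$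 such that $t+\tau$ is a stopping time of the natural filtration of $B$), for $(t,x)\in[0,1)\times\mathbb{R}$, and the optimal stopping boundary is the function of $t\in[0,1)$ such that the set where the value function at $(t,x)$ equals $x$ is the set of $(t,x)$ with $x$ greater than or equal to the boundary at $t$. *)

theory Defs
  imports "HOL-Probability.Probability"
begin

definition standard_brownian_motion :: "'a measure \<Rightarrow> (real \<Rightarrow> 'a \<Rightarrow> real) \<Rightarrow> bool" where
  "standard_brownian_motion M B \<longleftrightarrow>
     prob_space M \<and>
     (\<forall>t\<ge>0. B t \<in> borel_measurable M) \<and>
     (AE \<omega> in M. B 0 \<omega> = 0) \<and>
     (\<forall>\<omega>\<in>space M. continuous_on {0..} (\<lambda>t. B t \<omega>)) \<and>
     (\<forall>s t. 0 \<le> s \<and> s < t \<longrightarrow>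
        distributed M lborel (\<lambda>\<omega>. B t \<omega> - B s \<omega>) (normal_density 0 (sqrt (t - s)))) \<and>
     (\<forall>(n::nat) (t :: nat \<Rightarrow> real). 0 \<le> t 0 \<and> (\<forall>i<n. t i < t (Suc i)) \<longrightarrow>
        prob_space.indep_vars M (\<lambda>_. borel) (\<lambda>i \<omega>. B (t (Suc i)) \<omega> - B (t i) \<omega>) {..<n})"

definition natural_filtration :: "'a measure \<Rightarrow> (real \<Rightarrow> 'a \<Rightarrow> real) \<Rightarrow> real \<Rightarrow> 'a measure" where
  "natural_filtration M B s =
     sigma (space M) {B u -` A \<inter> space M | u A. 0 \<le> u \<and> u \<le> s \<and> A \<in> sets borel}"

definition ou_bridge_drift :: "real \<Rightarrow> real \<Rightarrow> real \<Rightarrow> real \<Rightarrow> real" where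
  "ou_bridge_drift \<alpha> z s y = \<alpha> * ((z - cosh (\<alpha> * (1 - s)) * y) / sinh (\<alpha> * (1 - s)))"

definition brownian_bridge_drift :: "real \<Rightarrow> real \<Rightarrow> real \<Rightarrow> real" where
  "brownian_bridge_drift z s y = (z - y) / (1 - s)"

(* "y solves dY = b(s, Y) ds + \<gamma> dw on [t,1) with Y(t) = x, and Y(1) = z", where w is one
   path of the driving noise.  The noise is additive with constant coefficient, so the stochastic
   integral over [t,s] is \<gamma> * (w s - w t) and the SDE is an integral equation for each path.
   The drifts above are singular at time 1, hence the equation is only required before 1;
   the terminal value is attained continuously. *)
definition bridge_path ::
    "(real \<Rightarrow> real \<Rightarrow> real) \<Rightarrow> real \<Rightarrow> real \<Rightarrow> real \<Rightarrow> real \<Rightarrow> (real \<Rightarrow> real) \<Rightarrow> (real \<Rightarrow> real) \<Rightarrow> bool" where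
  "bridge_path b \<gamma> z t x w y \<longleftrightarrow>
     continuous_on {t..1} y \<and>
     (\<forall>s\<in>{t..<1}. y s = x + integral {t..s} (\<lambda>u. b u (y u)) + \<gamma> * (w s - w t)) \<and>
     y 1 = z"

(* sup of E[Z_{t+\<tau>} | Z_t = x]: conditioning on Z_t = x means that Z is the solution of the
   SDE started from x at time t.  For both drifts above that solution exists and is unique for every
   continuous driving path, so Z does not contribute to the supremum. *)
definition value_function ::
    "'a measure \<Rightarrow> (real \<Rightarrow> 'a \<Rightarrow> real) \<Rightarrow> (real \<Rightarrow> real \<Rightarrow> real) \<Rightarrow> real \<Rightarrow> real \<Rightarrow> real \<Rightarrow> real \<Rightarrow> real" where
  "value_function M B b \<gamma> z t x =
     Sup {integral\<^sup>L M (\<lambda>\<omega>. Z (t + \<tau> \<omega>) \<omega>) | Z \<tau>.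
            (\<forall>\<omega>\<in>space M. bridge_path b \<gamma> z t x (\<lambda>s. B s \<omega>) (\<lambda>s. Z s \<omega>)) \<and>
            (\<forall>\<omega>\<in>space M. 0 \<le> \<tau> \<omega> \<and> \<tau> \<omega> \<le> 1 - t) \<and>
            stopping_time (natural_filtration M B) (\<lambda>\<omega>. t + \<tau> \<omega>)}"

definition is_stopping_boundary :: "(real \<Rightarrow> real \<Rightarrow> real) \<Rightarrow> (real \<Rightarrow> real) \<Rightarrow> bool" where
  "is_stopping_boundary V \<beta> \<longleftrightarrow>
     {(t, x). t \<in> {0..<1} \<and> V t x = x} = {(t, x). t \<in> {0..<1} \<and> x \<ge> \<beta> t}"

end

theory Submission
  imports Defs
begin

text \<open>Both drifts belong to one family, continuous at \<open>\<alpha> = 0\<close>, whose members are linear in the state with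
  a damping coefficient. The coefficients differ from those of the Brownian bridge by at most
  \<open>\<alpha>\<^sup>2\<close>, uniformly up to the singularity at time 1, so along each driving path the two bridges differ
  at time \<open>s\<close> by at most \<open>\<alpha>\<^sup>2\<close> times the time integral of \<open>\<bar>z\<bar> + \<bar>Y\<bar>\<close> up to \<open>s\<close>, with \<open>Y\<close> the Brownian bridge.
  By optional stopping for \<open>B\<^sup>2 - s\<close>, the expectations at a stopping time \<open>T \<ge> t\<close> then differ by at most
  \<open>C \<alpha>\<^sup>2 E[T - t]\<close>, which yields convergence of the value functions. For the boundaries, lowering the
  starting point of the Brownian bridge from \<open>x\<close> to \<open>y\<close> lowers it by \<open>(x - y) (1 - s) / (1 - t)\<close>; if \<open>y\<close> is a
  stopping point, starting from \<open>x > y\<close> therefore loses at least \<open>(x - y) E[T - t] / (1 - t)\<close>, which beats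
  the perturbation as soon as \<open>\<alpha>\<close> is small, and \<open>x\<close> is a stopping point for the Ornstein--Uhlenbeck
  bridge.\<close>

section \<open>Drifts and linear equations along a fixed path\<close>

text \<open>The obstacle along a path is the pole of the drift at time 1: its Lipschitz constant in
  the state grows like \<open>1 / (1 - s)\<close>, which is not integrable, so a Gronwall estimate
  breaks down at time 1. The pole has the sign of a damping, however, so only the forcing term has
  to be integrated. Additive noise cancels in the difference of two solutions, which is thus a
  deterministic differentiable function for each path.

  For the boundaries, convergence of the values gives only one half. That the limiting value exceeds
  x is an open condition and persists for small \<alpha>. That it equals x is not, and a uniform
  error of order \<open>\<alpha>\<^sup>2\<close> would leave room for a small gain from continuing.
  The critical stopping times are those with very small \<open>E[T - t]\<close>. Retaining this
  factor in the perturbation estimate makes error and loss multiples of the same number, so that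
  comparing coefficients settles all stopping times at once.\<close>

definition bridge_scale :: "real \<Rightarrow> real \<Rightarrow> real" where
  "bridge_scale \<alpha> s = (if \<alpha> = 0 then 1 - s else sinh (\<alpha> * (1 - s)) / \<alpha>)"

definition bridge_drift :: "real \<Rightarrow> real \<Rightarrow> real \<Rightarrow> real \<Rightarrow> real" where
  "bridge_drift \<alpha> z s y = (z - cosh (\<alpha> * (1 - s)) * y) / bridge_scale \<alpha> s"

lemma ou_bridge_drift_eq: "\<alpha> \<noteq> 0 \<Longrightarrow> ou_bridge_drift \<alpha> z = bridge_drift \<alpha> z"
  by (simp add: fun_eq_iff ou_bridge_drift_def bridge_drift_def bridge_scale_def)

lemma brownian_bridge_drift_eq: "brownian_bridge_drift z = bridge_drift 0 z"
  by (simp add: fun_eq_iff brownian_bridge_drift_def bridge_drift_def bridge_scale_def)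

lemma bridge_scale_pos: "s < 1 \<Longrightarrow> 0 < bridge_scale \<alpha> s"
  by (cases \<alpha> "0::real" rule: linorder_cases)
     (auto simp: bridge_scale_def divide_neg_neg mult_neg_pos)

lemma bridge_scale_1 [simp]: "bridge_scale \<alpha> 1 = 0"
  by (simp add: bridge_scale_def)

text \<open>With \<open>c u = cosh (\<alpha> * (1 - u)) / bridge_scale \<alpha> u\<close> this says
  \<open>h' = - c h\<close> for the scale \<open>h\<close>: it spans the solutions of the
  homogeneous bridge equation before time 1. This makes it the integrating factor of the explicit
  solution below.\<close>

lemma bridge_scale_deriv: "(bridge_scale \<alpha> has_real_derivative - cosh (\<alpha> * (1 - s))) (at s)"
proof (cases "\<alpha> = 0")
  case True
  then have "bridge_scale \<alpha> = (\<lambda>s. 1 - s)" by (auto simp: bridge_scale_def)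
  then show ?thesis using True by (auto intro!: derivative_eq_intros)
next
  case False
  then have "bridge_scale \<alpha> = (\<lambda>s. sinh (\<alpha> * (1 - s)) / \<alpha>)" by (auto simp: bridge_scale_def)
  then show ?thesis using False by (auto intro!: derivative_eq_intros)
qed

lemma continuous_on_bridge_scale [continuous_intros]: "continuous_on A (bridge_scale \<alpha>)"
  by (meson DERIV_isCont bridge_scale_deriv continuous_at_imp_continuous_on)

section \<open>Comparison of the drift coefficients, uniformly up to the pole\<close>

lemma cosh_le_one_plus_square:
  fixes k :: real
  assumes "0 \<le> k" "k \<le> 1"
  shows "cosh k \<le> 1 + k\<^sup>2"
proof -
  have 1: "exp k \<le> 1 + k + k\<^sup>2" using assms by (intro exp_bound)
  have "exp (-k) = 1 / exp k" by (simp add: exp_minus inverse_eq_divide)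
  also have "\<dots> \<le> 1 / (1 + k)" using assms exp_ge_add_one_self[of k] by (intro divide_left_mono) auto
  also have "\<dots> \<le> 1 - k + k\<^sup>2"
  proof -
    \<comment> \<open>The product equals \<open>1 + k^3\<close>. The linear terms of the bounds for
      \<open>exp k\<close> and \<open>exp (-k)\<close> then cancel in their average
      \<open>cosh k\<close>.\<close>
    have "1 \<le> (1 - k + k\<^sup>2) * (1 + k)" using assms by (simp add: algebra_simps power2_eq_square)
    then show ?thesis using assms by (simp add: divide_le_eq)
  qed
  finally show ?thesis using 1 by (simp add: cosh_field_def)
qed

lemma sinh_ge_self: "0 \<le> k \<Longrightarrow> k \<le> sinh (k::real)"
proof -
  assume k: "0 \<le> k"
  have "(\<lambda>x. sinh x - x) 0 \<le> (\<lambda>x. sinh x - x) k"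
    by (rule DERIV_nonneg_imp_increasing_open[OF k])
       (auto intro!: derivative_eq_intros continuous_intros exI cosh_real_ge_1)
  then show ?thesis by simp
qed

lemma sinh_le_mult_cosh: "0 \<le> k \<Longrightarrow> sinh (k::real) \<le> k * cosh k"
proof -
  assume k: "0 \<le> k"
  have "(\<lambda>x. x * cosh x - sinh x) 0 \<le> (\<lambda>x. x * cosh x - sinh x) k"
    by (rule DERIV_nonneg_imp_increasing_open[OF k])
       (auto intro!: derivative_eq_intros continuous_intros exI)
  then show ?thesis by simp
qed

text \<open>With \<open>r = 1 - s\<close> and \<open>k = |\<alpha>| r\<close> the two coefficients
  are \<open>(k / sinh k) / r\<close> and \<open>(k coth k) / r\<close>. Both numerators differ from
  1 by at most \<open>k^2\<close>, and \<open>k^2 / r = \<alpha>^2 r\<close>: the quadratic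
  deviation absorbs the pole.\<close>

lemma bridge_coefficient_bounds:
  assumes "\<bar>\<alpha>\<bar> \<le> 1" "0 \<le> s" "s < 1"
  shows "\<bar>1 / bridge_scale \<alpha> s - 1 / (1 - s)\<bar> \<le> \<alpha>\<^sup>2"
    and "\<bar>cosh (\<alpha> * (1 - s)) / bridge_scale \<alpha> s - 1 / (1 - s)\<bar> \<le> \<alpha>\<^sup>2"
proof -
  define r where "r = 1 - s"
  define k where "k = \<bar>\<alpha>\<bar> * r"
  have r: "0 < r" "r \<le> 1" using assms by (auto simp: r_def)
  show "\<bar>1 / bridge_scale \<alpha> s - 1 / (1 - s)\<bar> \<le> \<alpha>\<^sup>2"
    and "\<bar>cosh (\<alpha> * (1 - s)) / bridge_scale \<alpha> s - 1 / (1 - s)\<bar> \<le> \<alpha>\<^sup>2"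
  proof (goal_cases)
    case 1 show ?case
    proof (cases "\<alpha> = 0")
      case True then show ?thesis by (simp add: bridge_scale_def)
    next
      case False
      have k: "0 < k" "k \<le> 1" using False r assms
        by (auto simp: k_def mult_le_one)
      have sc: "bridge_scale \<alpha> s = sinh k / \<bar>\<alpha>\<bar>"
        using False by (auto simp: bridge_scale_def k_def r_def abs_if)
      have a: "\<bar>\<alpha>\<bar> = k / r" using r by (simp add: k_def)
      have e: "1 / bridge_scale \<alpha> s - 1 / (1 - s) = (k / sinh k - 1) / r"
        using k r unfolding sc a by (simp add: r_def[symmetric] diff_divide_distrib)
      have "k / sinh k \<le> 1" using sinh_ge_self[of k] k by simp
      moreover have "1 - k\<^sup>2 \<le> k / sinh k"
      proof -
        \<comment> \<open>Uses \<open>sinh k \<le> k cosh k \<le> k (1 + k^2)\<close>; the two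
          remaining brackets multiply to \<open>1 - k^4 \<le> 1\<close>.\<close>
        have "(1 - k\<^sup>2) * sinh k \<le> (1 - k\<^sup>2) * (k * (1 + k\<^sup>2))"
          using k sinh_le_mult_cosh[of k] cosh_le_one_plus_square[of k]
          by (intro mult_left_mono order_trans[OF sinh_le_mult_cosh]) (auto simp: power_le_one)
        also have "\<dots> \<le> k" using k by (simp add: algebra_simps power2_eq_square)
        finally show ?thesis using k by (simp add: pos_le_divide_eq)
      qed
      ultimately have "\<bar>k / sinh k - 1\<bar> \<le> k\<^sup>2" by simp
      then have "\<bar>(k / sinh k - 1) / r\<bar> \<le> k\<^sup>2 / r" using r by (simp add: divide_right_mono)
      also have "\<dots> = \<alpha>\<^sup>2 * r" using r by (simp add: k_def power2_eq_square)
      also have "\<dots> \<le> \<alpha>\<^sup>2" using r by (simp add: mult_left_le)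
      finally show ?thesis by (simp add: e)
    qed
  next
    case 2 show ?case
    proof (cases "\<alpha> = 0")
      case True then show ?thesis by (simp add: bridge_scale_def)
    next
      case False
      have k: "0 < k" "k \<le> 1" using False r assms
        by (auto simp: k_def mult_le_one)
      have sc: "bridge_scale \<alpha> s = sinh k / \<bar>\<alpha>\<bar>" and co: "cosh (\<alpha> * (1 - s)) = cosh k"
        using False by (auto simp: bridge_scale_def k_def r_def abs_if)
      have a: "\<bar>\<alpha>\<bar> = k / r" using r by (simp add: k_def)
      have e: "cosh (\<alpha> * (1 - s)) / bridge_scale \<alpha> s - 1 / (1 - s) = (k * cosh k / sinh k - 1) / r"
        using k r unfolding sc a co by (simp add: r_def[symmetric] diff_divide_distrib ac_simps)
      have "1 \<le> k * cosh k / sinh k" using sinh_le_mult_cosh[of k] k by simp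
      moreover have "k * cosh k / sinh k \<le> 1 + k\<^sup>2"
      proof -
        have "k * cosh k \<le> sinh k * (1 + k\<^sup>2)"
          using k sinh_ge_self[of k] cosh_le_one_plus_square[of k] by (intro mult_mono) auto
        then show ?thesis using k by (simp add: pos_divide_le_eq mult.commute)
      qed
      ultimately have "\<bar>k * cosh k / sinh k - 1\<bar> \<le> k\<^sup>2" by simp
      then have "\<bar>(k * cosh k / sinh k - 1) / r\<bar> \<le> k\<^sup>2 / r" using r by (simp add: divide_right_mono)
      also have "\<dots> = \<alpha>\<^sup>2 * r" using r by (simp add: k_def power2_eq_square)
      also have "\<dots> \<le> \<alpha>\<^sup>2" using r by (simp add: mult_left_le)
      finally show ?thesis by (simp add: e)
    qed
  qed
qed

lemma bridge_drift_diff: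
  assumes "\<bar>\<alpha>\<bar> \<le> 1" "0 \<le> s" "s < 1"
  shows "\<bar>bridge_drift \<alpha> z s y - bridge_drift 0 z s y\<bar> \<le> \<alpha>\<^sup>2 * (\<bar>z\<bar> + \<bar>y\<bar>)"
proof -
  have "bridge_drift \<alpha> z s y - bridge_drift 0 z s y =
     z * (1 / bridge_scale \<alpha> s - 1 / (1 - s)) - y * (cosh (\<alpha> * (1 - s)) / bridge_scale \<alpha> s - 1 / (1 - s))"
    by (simp add: bridge_drift_def bridge_scale_def[of 0] algebra_simps diff_divide_distrib)
  also have "\<bar>\<dots>\<bar> \<le> \<bar>z\<bar> * \<alpha>\<^sup>2 + \<bar>y\<bar> * \<alpha>\<^sup>2"
    by (intro order_trans[OF abs_triangle_ineq4] add_mono)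
       (auto simp: abs_mult intro!: mult_left_mono bridge_coefficient_bounds assms)
  finally show ?thesis by (simp add: algebra_simps)
qed

text \<open>The square root of \<open>D\<^sup>2 + e\<^sup>2\<close> smooths \<open>\<bar>D\<bar>\<close>; its derivative is at most \<open>\<bar>g\<bar>\<close>
  because the damping term \<open>- c D\<close> has the right sign.\<close>
lemma damped_linear_ode_bound:
  fixes D g c :: "real \<Rightarrow> real"
  assumes ts: "t \<le> s" and cD: "continuous_on {t..s} D" and cg: "continuous_on {t..s} g"
    and D: "\<And>u. t < u \<Longrightarrow> u < s \<Longrightarrow> (D has_real_derivative g u - c u * D u) (at u)"
    and c: "\<And>u. t < u \<Longrightarrow> u < s \<Longrightarrow> 0 \<le> c u"
  shows "\<bar>D s\<bar> \<le> \<bar>D t\<bar> + integral {t..s} (\<lambda>u. \<bar>g u\<bar>)"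
proof (rule field_le_epsilon)
  fix e :: real assume e: "0 < e"
  \<comment> \<open>The smoothing keeps \<open>\<phi>\<close> differentiable at zeros of
    \<open>D\<close>. It costs at most \<open>e\<close> at the left end point and nothing at the
    right one.\<close>
  define \<phi> where "\<phi> u = sqrt ((D u)\<^sup>2 + e\<^sup>2)" for u
  define G where "G u = integral {t..u} (\<lambda>u. \<bar>g u\<bar>)" for u
  have pos: "0 < (D u)\<^sup>2 + e\<^sup>2" for u using e by (simp add: add_nonneg_pos)
  have cag: "continuous_on {t..s} (\<lambda>u. \<bar>g u\<bar>)" by (intro continuous_intros cg)
  have "(\<lambda>u. \<phi> u - G u) t \<ge> (\<lambda>u. \<phi> u - G u) s"
  proof (rule DERIV_nonpos_imp_decreasing_open[OF ts])
    fix u assume u: "t < u" "u < s"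
    have "(G has_real_derivative \<bar>g u\<bar>) (at u within {t..s})"
      unfolding G_def using u by (intro integral_has_real_derivative cag) auto
    then have G: "(G has_real_derivative \<bar>g u\<bar>) (at u)"
      using u by (simp add: at_within_Icc_at)
    have ph: "(\<phi> has_real_derivative (D u * (g u - c u * D u)) / \<phi> u) (at u)"
    proof -
      have "((\<lambda>v. (D v)\<^sup>2 + e\<^sup>2) has_real_derivative 2 * D u * (g u - c u * D u)) (at u)"
        by (rule derivative_eq_intros D[OF u] refl)+ simp
      note d = DERIV_chain2[OF DERIV_real_sqrt[OF pos[of u]] this]
      have *: "inverse r / 2 * (2 * d * k) = d * k / r" for r d k :: real
        by (cases "r = 0") (simp_all add: field_simps)
      show ?thesis using d unfolding \<phi>_def * .
    qed
    have php: "0 < \<phi> u" using pos[of u] by (simp add: \<phi>_def)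
    have "\<bar>D u\<bar> \<le> \<phi> u" unfolding \<phi>_def by (rule real_le_rsqrt) auto
    then have "\<bar>g u\<bar> * \<bar>D u\<bar> \<le> \<bar>g u\<bar> * \<phi> u" by (rule mult_left_mono) simp
    moreover have "D u * g u \<le> \<bar>g u\<bar> * \<bar>D u\<bar>"
      using abs_ge_self[of "g u * D u"] by (simp add: abs_mult mult.commute)
    ultimately have "D u * g u \<le> \<bar>g u\<bar> * \<phi> u" by linarith
    moreover have "0 \<le> c u * (D u * D u)" using c[OF u] by simp
    ultimately have "D u * (g u - c u * D u) \<le> \<bar>g u\<bar> * \<phi> u" by (simp add: algebra_simps)
    then have "(D u * (g u - c u * D u)) / \<phi> u - \<bar>g u\<bar> \<le> 0"
      using php by (simp add: divide_le_eq)
    then show "\<exists>y. ((\<lambda>u. \<phi> u - G u) has_real_derivative y) (at u) \<and> y \<le> 0"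
      using DERIV_diff[OF ph G] by blast
  next
    show "continuous_on {t..s} (\<lambda>u. \<phi> u - G u)"
      unfolding \<phi>_def G_def
      by (intro continuous_intros cD indefinite_integral_continuous_1 integrable_continuous_interval cag)
  qed
  then have "\<phi> s \<le> \<phi> t + integral {t..s} (\<lambda>u. \<bar>g u\<bar>)" by (simp add: G_def)
  moreover have "\<bar>D s\<bar> \<le> \<phi> s" unfolding \<phi>_def by (rule real_le_rsqrt) auto
  moreover have "\<phi> t \<le> \<bar>D t\<bar> + e"
    unfolding \<phi>_def using e sqrt_sum_squares_le_sum_abs[of "D t" e] by simp
  ultimately show "\<bar>D s\<bar> \<le> \<bar>D t\<bar> + integral {t..s} (\<lambda>u. \<bar>g u\<bar>) + e" by simp
qed

section \<open>Differentiation, comparison and uniqueness of solutions along one driving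
  path\<close>

lemma bridge_path_start:
  assumes "bridge_path b \<gamma> z t x w y" "t < 1"
  shows "y t = x"
  using assms by (auto simp: bridge_path_def)

lemma bridge_path_continuous:
  assumes "bridge_path b \<gamma> z t x w y"
  shows "continuous_on {t..1} y"
  using assms by (auto simp: bridge_path_def)

lemma continuous_on_bridge_drift [continuous_intros]:
  assumes "continuous_on A y" "\<And>u. u \<in> A \<Longrightarrow> u < 1"
  shows "continuous_on A (\<lambda>u. bridge_drift \<alpha> z u (y u))"
  unfolding bridge_drift_def using bridge_scale_pos[of _ \<alpha>] assms
  by (intro continuous_intros) (auto simp: less_imp_neq[symmetric])

text \<open>Removing the noise leaves a time integral of a continuous drift, which can be
  differentiated; \<open>y\<close> itself inherits the roughness of \<open>w\<close>. The subtracted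
  term depends on \<open>w\<close> alone, so it drops out of the difference of two
  solutions.\<close>

lemma bridge_path_deriv:
  assumes y: "bridge_path (bridge_drift \<alpha> z) \<gamma> z t x w y" and u: "t < u" "u < 1"
  shows "((\<lambda>s. y s - \<gamma> * (w s - w t)) has_real_derivative bridge_drift \<alpha> z u (y u)) (at u)"
proof -
  \<comment> \<open>Cutting the interval at \<open>s < 1\<close> keeps the drift continuous up to
    its end point.\<close>
  obtain s where s: "u < s" "s < 1" using u dense by blast
  have "continuous_on {t..s} y"
    by (rule continuous_on_subset[OF bridge_path_continuous[OF y]]) (use s in auto)
  then have "((\<lambda>s. integral {t..s} (\<lambda>u. bridge_drift \<alpha> z u (y u))) has_real_derivative
      bridge_drift \<alpha> z u (y u)) (at u within {t..s})"
    using u s by (intro integral_has_real_derivative continuous_intros) auto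
  then have "((\<lambda>s. integral {t..s} (\<lambda>u. bridge_drift \<alpha> z u (y u))) has_real_derivative
      bridge_drift \<alpha> z u (y u)) (at u)"
    using u s by (simp add: at_within_Icc_at)
  then have "((\<lambda>s. x + integral {t..s} (\<lambda>u. bridge_drift \<alpha> z u (y u))) has_real_derivative
      bridge_drift \<alpha> z u (y u)) (at u)"
    by (auto intro!: derivative_eq_intros)
  then show ?thesis
    by (rule has_field_derivative_transform_within_open[of _ _ _ "{t<..<1}"])
       (use y u in \<open>auto simp: bridge_path_def\<close>)
qed

text \<open>The difference solves \<open>D' = g - c D\<close> with \<open>D t = 0\<close>, where
  \<open>c\<close> is the damping coefficient for \<alpha> and \<open>g\<close> is the difference of
  the two drifts along \<open>y0\<close>. Since \<open>g\<close> is evaluated along the Brownian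
  bridge and not along \<open>y\<close>, moments of that one process suffice later. At time 1 both
  paths equal \<open>z\<close>.\<close>

lemma bridge_path_perturbation:
  assumes y: "bridge_path (bridge_drift \<alpha> z) \<gamma> z t x w y"
    and y0: "bridge_path (bridge_drift 0 z) \<gamma> z t x w y0"
    and "\<bar>\<alpha>\<bar> \<le> 1" "0 \<le> t" "t \<le> s" "s \<le> 1"
  shows "\<bar>y s - y0 s\<bar> \<le> \<alpha>\<^sup>2 * integral {t..s} (\<lambda>u. \<bar>z\<bar> + \<bar>y0 u\<bar>)"
proof (cases "s = 1")
  case True
  then have "y s = y0 s" using y y0 by (auto simp: bridge_path_def)
  moreover have "0 \<le> integral {t..s} (\<lambda>u. \<bar>z\<bar> + \<bar>y0 u\<bar>)"
    by (rule Henstock_Kurzweil_Integration.integral_nonneg)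
       (use True in \<open>auto intro!: integrable_continuous_interval continuous_intros bridge_path_continuous[OF y0]\<close>)
  ultimately show ?thesis by simp
next
  case False
  with assms have s: "s < 1" by simp
  define g where "g u = bridge_drift \<alpha> z u (y0 u) - bridge_drift 0 z u (y0 u)" for u
  have sub: "continuous_on {t..s} y" "continuous_on {t..s} y0"
    using s by (auto intro: continuous_on_subset[OF bridge_path_continuous[OF y]]
        continuous_on_subset[OF bridge_path_continuous[OF y0]])
  have "\<bar>y s - y0 s\<bar> \<le> \<bar>y t - y0 t\<bar> + integral {t..s} (\<lambda>u. \<bar>g u\<bar>)"
  proof (rule damped_linear_ode_bound[where c = "\<lambda>u. cosh (\<alpha> * (1 - u)) / bridge_scale \<alpha> u"])
    show "continuous_on {t..s} g" unfolding g_def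
      using s by (intro continuous_intros sub) auto
  next
    fix u assume u: "t < u" "u < s"
    then have u1: "u < 1" using s by simp
    show "0 \<le> cosh (\<alpha> * (1 - u)) / bridge_scale \<alpha> u"
      using bridge_scale_pos[OF u1, of \<alpha>] by simp
    have "((\<lambda>s. y s - y0 s) has_real_derivative bridge_drift \<alpha> z u (y u) - bridge_drift 0 z u (y0 u)) (at u)"
      using DERIV_diff[OF bridge_path_deriv[OF y u(1) u1] bridge_path_deriv[OF y0 u(1) u1]] by simp
    moreover have "bridge_drift \<alpha> z u (y u) - bridge_drift 0 z u (y0 u)
        = g u - cosh (\<alpha> * (1 - u)) / bridge_scale \<alpha> u * (y u - y0 u)"
      unfolding g_def by (simp add: bridge_drift_def diff_divide_distrib algebra_simps)
    ultimately show "((\<lambda>s. y s - y0 s) has_real_derivative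
        g u - cosh (\<alpha> * (1 - u)) / bridge_scale \<alpha> u * (y u - y0 u)) (at u)" by simp
  qed (use assms in \<open>auto intro!: continuous_intros sub\<close>)
  also have "y t - y0 t = 0" using s assms bridge_path_start[OF y] bridge_path_start[OF y0] by simp
  also have "integral {t..s} (\<lambda>u. \<bar>g u\<bar>) \<le> integral {t..s} (\<lambda>u. \<alpha>\<^sup>2 * (\<bar>z\<bar> + \<bar>y0 u\<bar>))"
    by (rule integral_le)
       (use s assms in \<open>auto simp: g_def intro!: integrable_continuous_interval continuous_intros sub
          bridge_drift_diff\<close>)
  finally show ?thesis by simp
qed

text \<open>Two solutions differ by a solution of the damped equation with zero forcing and zero
  start.\<close>

lemma bridge_path_unique:
  assumes y: "bridge_path (bridge_drift \<alpha> z) \<gamma> z t x w y"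
    and y': "bridge_path (bridge_drift \<alpha> z) \<gamma> z t x w y'"
    and "t \<le> s" "s \<le> 1"
  shows "y s = y' s"
proof (cases "s = 1")
  case True
  then show ?thesis using y y' by (auto simp: bridge_path_def)
next
  case False
  with assms have s: "s < 1" by simp
  have sub: "continuous_on {t..s} y" "continuous_on {t..s} y'"
    using s by (auto intro: continuous_on_subset[OF bridge_path_continuous[OF y]]
        continuous_on_subset[OF bridge_path_continuous[OF y']])
  have "\<bar>y s - y' s\<bar> \<le> \<bar>y t - y' t\<bar> + integral {t..s} (\<lambda>u. \<bar>0\<bar>)"
  proof (rule damped_linear_ode_bound[where c = "\<lambda>u. cosh (\<alpha> * (1 - u)) / bridge_scale \<alpha> u"])
    fix u assume u: "t < u" "u < s"
    then have u1: "u < 1" using s by simp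
    show "0 \<le> cosh (\<alpha> * (1 - u)) / bridge_scale \<alpha> u"
      using bridge_scale_pos[OF u1, of \<alpha>] by simp
    have "((\<lambda>s. y s - y' s) has_real_derivative bridge_drift \<alpha> z u (y u) - bridge_drift \<alpha> z u (y' u)) (at u)"
      using DERIV_diff[OF bridge_path_deriv[OF y u(1) u1] bridge_path_deriv[OF y' u(1) u1]] by simp
    then show "((\<lambda>s. y s - y' s) has_real_derivative
        0 - cosh (\<alpha> * (1 - u)) / bridge_scale \<alpha> u * (y u - y' u)) (at u)"
      by (simp add: bridge_drift_def diff_divide_distrib algebra_simps)
  qed (use assms in \<open>auto intro!: continuous_intros sub\<close>)
  then show ?thesis using s assms bridge_path_start[OF y] bridge_path_start[OF y'] by simp
qed

text \<open>The function \<open>(1 - s) (y s - x - \<gamma> (w s - w t))\<^sup>2\<close> is a Lyapunov function for the Brownian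
  bridge drift; its dissipation controls the integral on the left.\<close>
lemma brownian_bridge_path_integral_bound:
  assumes y: "bridge_path (bridge_drift 0 z) \<gamma> z t x w y"
    and w: "continuous_on {t..1} w" and ts: "t \<le> s" "s \<le> 1" "t < 1"
  shows "integral {t..s} (\<lambda>u. \<bar>z\<bar> + \<bar>y u\<bar>)
    \<le> (\<bar>z\<bar> + \<bar>x\<bar> + 2 + 2 * (z - x)\<^sup>2 + 3 * \<gamma>\<^sup>2) * ((s - t) + integral {t..s} (\<lambda>u. (w u - w t)\<^sup>2))"
proof -
  \<comment> \<open>With \<open>p = z - x - \<gamma> W\<close>, bounding \<open>|y|\<close> costs
    \<open>|x| + 2 + q^2 + (\<gamma> W)^2\<close> and bounding \<open>p^2\<close> costs
    \<open>2 (z - x)^2 + 2 (\<gamma> W)^2\<close>. Together with \<open>|z|\<close> these give the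
    constant part of \<open>C\<close>, and the three copies of \<open>(\<gamma> W)^2\<close> give
    \<open>3 \<gamma>^2\<close>.\<close>
  define C where "C = \<bar>z\<bar> + \<bar>x\<bar> + 2 + 2 * (z - x)\<^sup>2 + 3 * \<gamma>\<^sup>2"
  define W where "W u = w u - w t" for u
  define q where "q u = y u - \<gamma> * W u - x" for u
  have sub: "continuous_on {t..s} y" "continuous_on {t..s} W"
    unfolding W_def using ts
    by (auto intro!: continuous_intros continuous_on_subset[OF bridge_path_continuous[OF y]]
        continuous_on_subset[OF w])
  define G where "G v = C * ((v - t) + integral {t..v} (\<lambda>u. (W u)\<^sup>2)) - integral {t..v} (\<lambda>u. \<bar>z\<bar> + \<bar>y u\<bar>)
      - (1 - v) * (q v)\<^sup>2" for v
  have c1: "continuous_on {t..s} (\<lambda>u. (W u)\<^sup>2)" and c2: "continuous_on {t..s} (\<lambda>u. \<bar>z\<bar> + \<bar>y u\<bar>)"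
    by (intro continuous_intros sub)+
  have "G t \<le> G s"
  proof (rule DERIV_nonneg_imp_increasing_open[OF ts(1)])
    fix u assume u: "t < u" "u < s"
    then have u1: "u < 1" using ts by simp
    have d1: "((\<lambda>v. integral {t..v} (\<lambda>u. (W u)\<^sup>2)) has_real_derivative (W u)\<^sup>2) (at u)"
      using integral_has_real_derivative[OF c1, of u] u by (simp add: at_within_Icc_at)
    have d2: "((\<lambda>v. integral {t..v} (\<lambda>u. \<bar>z\<bar> + \<bar>y u\<bar>)) has_real_derivative \<bar>z\<bar> + \<bar>y u\<bar>) (at u)"
      using integral_has_real_derivative[OF c2, of u] u by (simp add: at_within_Icc_at)
    have d3: "(q has_real_derivative (z - y u) / (1 - u)) (at u)"
      using DERIV_diff[OF bridge_path_deriv[OF y u(1) u1] DERIV_const[of x]]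
      unfolding q_def W_def by (simp add: bridge_drift_def bridge_scale_def)
    have "(G has_real_derivative
       C * (1 + (W u)\<^sup>2) - (\<bar>z\<bar> + \<bar>y u\<bar>) - (- (q u)\<^sup>2 + (1 - u) * (2 * q u * ((z - y u) / (1 - u))))) (at u)"
      unfolding G_def by (rule derivative_eq_intros d1 d2 d3 refl)+ simp
    also have "(1 - u) * (2 * q u * ((z - y u) / (1 - u))) = 2 * q u * (z - y u)"
      using u1 by simp
    finally have d: "(G has_real_derivative
       C * (1 + (W u)\<^sup>2) - (\<bar>z\<bar> + \<bar>y u\<bar>) - (- (q u)\<^sup>2 + 2 * q u * (z - y u))) (at u)" .
    have yu: "y u = x + q u + \<gamma> * W u" by (simp add: q_def)
    define p where "p = z - x - \<gamma> * W u"
    \<comment> \<open>Substituting \<open>z - y = p - q\<close> exposes the dissipation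
      \<open>-3 q^2\<close>: one \<open>q^2\<close> pays for the mixed term, one for the bound on
      \<open>|y|\<close>, and one is left over.\<close>
    have e1: "- (q u)\<^sup>2 + 2 * q u * (z - y u) = - 3 * (q u)\<^sup>2 + 2 * (q u * p)"
      unfolding yu p_def by (simp add: power2_eq_square algebra_simps)
    have e2: "2 * (q u * p) \<le> (q u)\<^sup>2 + p\<^sup>2"
      using zero_le_power2[of "q u - p"] by (simp add: power2_diff)
    have e3: "p\<^sup>2 \<le> 2 * (z - x)\<^sup>2 + 2 * (\<gamma> * W u)\<^sup>2"
      using zero_le_power2[of "(z - x) + \<gamma> * W u"] by (simp add: p_def power2_sum power2_diff algebra_simps)
    have ab: "\<bar>a\<bar> \<le> 1 + a\<^sup>2" for a :: real
    proof -
      have "0 \<le> (\<bar>a\<bar> - 1)\<^sup>2" by simp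
      then show ?thesis by (simp add: power2_diff)
    qed
    have "\<bar>y u\<bar> \<le> \<bar>x\<bar> + \<bar>q u\<bar> + \<bar>\<gamma> * W u\<bar>" unfolding yu by linarith
    also have "\<dots> \<le> \<bar>x\<bar> + (1 + (q u)\<^sup>2) + (1 + (\<gamma> * W u)\<^sup>2)" by (intro add_mono ab) auto
    finally have e4: "\<bar>y u\<bar> \<le> \<bar>x\<bar> + (1 + (q u)\<^sup>2) + (1 + (\<gamma> * W u)\<^sup>2)" .
    have "C * (1 + (W u)\<^sup>2) = C + (\<bar>z\<bar> + \<bar>x\<bar> + 2 + 2 * (z - x)\<^sup>2) * (W u)\<^sup>2 + 3 * (\<gamma> * W u)\<^sup>2"
      by (simp add: C_def algebra_simps power_mult_distrib)
    moreover have "0 \<le> (\<bar>z\<bar> + \<bar>x\<bar> + 2 + 2 * (z - x)\<^sup>2) * (W u)\<^sup>2"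
      by (intro mult_nonneg_nonneg add_nonneg_nonneg) auto
    moreover have "\<bar>z\<bar> + \<bar>x\<bar> + 2 + 2 * (z - x)\<^sup>2 \<le> C" by (simp add: C_def)
    moreover have "0 \<le> (q u)\<^sup>2" by simp
    ultimately have "0 \<le> C * (1 + (W u)\<^sup>2) - (\<bar>z\<bar> + \<bar>y u\<bar>) - (- (q u)\<^sup>2 + 2 * q u * (z - y u))"
      using e1 e2 e3 e4 by linarith
    with d show "\<exists>l. (G has_real_derivative l) (at u) \<and> 0 \<le> l" by blast
  next
    show "continuous_on {t..s} G"
      unfolding G_def q_def
      by (intro continuous_intros sub indefinite_integral_continuous_1 integrable_continuous_interval c1 c2)
  qed
  moreover have "q t = 0" using bridge_path_start[OF y] ts by (simp add: q_def W_def)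
  then have "G t = 0" by (simp add: G_def)
  moreover have "0 \<le> (1 - s) * (q s)\<^sup>2" using ts by simp
  ultimately have "integral {t..s} (\<lambda>u. \<bar>z\<bar> + \<bar>y u\<bar>) \<le> C * ((s - t) + integral {t..s} (\<lambda>u. (W u)\<^sup>2))"
    unfolding G_def by linarith
  then show ?thesis unfolding C_def W_def .
qed

text \<open>With \<open>v = w - w 1\<close>, the centred path \<open>q = y - z - \<gamma> v\<close>
  satisfies \<open>q' = - (q + \<gamma> v) / (1 - u)\<close>, and completing the square gives
  \<open>(q^2)' \<le> \<gamma>^2 v^2 / (1 - u)\<close>. The weight \<open>1 - s\<close> of the
  preceding Lyapunov function degenerates at time 1, so a pointwise bound up to there needs this
  second estimate. For Brownian motion \<open>v^2\<close> has mean \<open>1 - u\<close>, which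
  cancels the pole.\<close>

lemma brownian_bridge_path_pinned_bound:
  assumes y: "bridge_path (bridge_drift 0 z) \<gamma> z t x w y"
    and w: "continuous_on {t..1} w" and ts: "t \<le> s" "s < 1"
  shows "(y s - z - \<gamma> * (w s - w 1))\<^sup>2 \<le> (x - z - \<gamma> * (w t - w 1))\<^sup>2
    + \<gamma>\<^sup>2 * integral {t..s} (\<lambda>u. (w u - w 1)\<^sup>2 / (1 - u))"
proof -
  define v where "v u = w u - w 1" for u
  define q where "q u = y u - z - \<gamma> * v u" for u
  have sub: "continuous_on {t..s} y" "continuous_on {t..s} v"
    unfolding v_def using ts
    by (auto intro!: continuous_intros continuous_on_subset[OF bridge_path_continuous[OF y]]
        continuous_on_subset[OF w])
  have c1: "continuous_on {t..s} (\<lambda>u. (v u)\<^sup>2 / (1 - u))"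
    by (intro continuous_intros sub) (use ts in auto)
  define G where "G r = \<gamma>\<^sup>2 * integral {t..r} (\<lambda>u. (v u)\<^sup>2 / (1 - u)) - (q r)\<^sup>2" for r
  have "G t \<le> G s"
  proof (rule DERIV_nonneg_imp_increasing_open[OF ts(1)])
    fix u assume u: "t < u" "u < s"
    then have u1: "u < 1" using ts by simp
    have d1: "((\<lambda>r. integral {t..r} (\<lambda>u. (v u)\<^sup>2 / (1 - u))) has_real_derivative (v u)\<^sup>2 / (1 - u)) (at u)"
      using integral_has_real_derivative[OF c1, of u] u by (simp add: at_within_Icc_at)
    have qe: "q = (\<lambda>s. (y s - \<gamma> * (w s - w t)) - (z + \<gamma> * (w t - w 1)))"
      by (auto simp: q_def v_def algebra_simps)
    have d3: "(q has_real_derivative (z - y u) / (1 - u)) (at u)"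
      using DERIV_diff[OF bridge_path_deriv[OF y u(1) u1] DERIV_const[of "z + \<gamma> * (w t - w 1)"]]
      unfolding qe by (simp add: bridge_drift_def bridge_scale_def)
    have "(G has_real_derivative
       \<gamma>\<^sup>2 * ((v u)\<^sup>2 / (1 - u)) - 2 * q u * ((z - y u) / (1 - u))) (at u)"
      unfolding G_def by (rule derivative_eq_intros d1 d3 refl)+ (simp add: ac_simps)
    also have "\<gamma>\<^sup>2 * ((v u)\<^sup>2 / (1 - u)) - 2 * q u * ((z - y u) / (1 - u)) =
       ((q u + \<gamma> * v u)\<^sup>2 + (q u)\<^sup>2) / (1 - u)"
    proof -
      have zy: "z - y u = - q u - \<gamma> * v u" by (simp add: q_def)
      show ?thesis unfolding zy times_divide_eq_right diff_divide_distrib[symmetric]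
        by (rule arg_cong[of _ _ "\<lambda>a. a / (1 - u)"]) (simp add: power2_eq_square algebra_simps)
    qed
    finally show "\<exists>l. (G has_real_derivative l) (at u) \<and> 0 \<le> l" using u1
      by (intro exI conjI) auto
  next
    show "continuous_on {t..s} G"
      unfolding G_def q_def
      by (intro continuous_intros sub indefinite_integral_continuous_1 integrable_continuous_interval c1)
  qed
  moreover have "y t = x" using bridge_path_start[OF y] ts by simp
  ultimately show ?thesis unfolding G_def q_def v_def by simp
qed

text \<open>The function \<open>1 - s\<close> solves the homogeneous equation and vanishes at time
  1, so adding a multiple of it moves the start and keeps the terminal value. The shift is
  deterministic and affine in time, hence its mean at a stopping time depends on \<open>E[T]\<close>
  alone.\<close>

lemma brownian_bridge_path_affine_start:
  assumes y: "bridge_path (bridge_drift 0 z) \<gamma> z t x w y"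
    and t: "t < 1"
  shows "bridge_path (bridge_drift 0 z) \<gamma> z t x' w (\<lambda>s. y s + (x' - x) * (1 - s) / (1 - t))"
  unfolding bridge_path_def
proof (intro conjI ballI)
  show "continuous_on {t..1} (\<lambda>s. y s + (x' - x) * (1 - s) / (1 - t))"
    using t by (intro continuous_intros bridge_path_continuous[OF y]) auto
  show "y 1 + (x' - x) * (1 - 1) / (1 - t) = z" using y by (simp add: bridge_path_def)
  fix s assume s: "s \<in> {t..<1}"
  have sub: "continuous_on {t..s} y"
    using s by (auto intro!: continuous_on_subset[OF bridge_path_continuous[OF y]])
  have "integral {t..s} (\<lambda>u. bridge_drift 0 z u (y u + (x' - x) * (1 - u) / (1 - t)))
      = integral {t..s} (\<lambda>u. bridge_drift 0 z u (y u) - (x' - x) / (1 - t))"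
  proof (rule integral_cong)
    fix u assume "u \<in> {t..s}"
    then have "u < 1" using s by auto
    then show "bridge_drift 0 z u (y u + (x' - x) * (1 - u) / (1 - t)) = bridge_drift 0 z u (y u) - (x' - x) / (1 - t)"
      by (simp add: bridge_drift_def bridge_scale_def diff_divide_distrib add_divide_distrib)
  qed
  also have "\<dots> = integral {t..s} (\<lambda>u. bridge_drift 0 z u (y u)) - (s - t) * ((x' - x) / (1 - t))"
    using s by (subst integral_diff) (auto intro!: integrable_continuous_interval continuous_intros sub)
  finally have I: "integral {t..s} (\<lambda>u. bridge_drift 0 z u (y u + (x' - x) * (1 - u) / (1 - t))) =
     integral {t..s} (\<lambda>u. bridge_drift 0 z u (y u)) - (s - t) * ((x' - x) / (1 - t))" .
  have ys: "y s = x + integral {t..s} (\<lambda>u. bridge_drift 0 z u (y u)) + \<gamma> * (w s - w t)"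
    using y s by (auto simp: bridge_path_def)
  have "(x' - x) * (1 - s) / (1 - t) = (x' - x) - (s - t) * ((x' - x) / (1 - t))"
    using t by (simp add: field_simps)
  then show "y s + (x' - x) * (1 - s) / (1 - t) =
      x' + integral {t..s} (\<lambda>u. bridge_drift 0 z u (y u + (x' - x) * (1 - u) / (1 - t))) + \<gamma> * (w s - w t)"
    unfolding I by (simp add: ys)
qed

text \<open>Variation of constants, with the stochastic integral integrated by parts so that it makes
  sense for every continuous path \<open>w\<close>.\<close>
definition bridge_solution :: "real \<Rightarrow> real \<Rightarrow> real \<Rightarrow> real \<Rightarrow> real \<Rightarrow> (real \<Rightarrow> real) \<Rightarrow> real \<Rightarrow> real" where
  "bridge_solution \<alpha> z \<gamma> t x w s = (if s < 1
     then bridge_scale \<alpha> s * (x / bridge_scale \<alpha> t +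
            integral {t..s} (\<lambda>u. (z - \<gamma> * cosh (\<alpha> * (1 - u)) * (w u - w t)) / (bridge_scale \<alpha> u)\<^sup>2))
          + \<gamma> * (w s - w t)
     else z)"

section \<open>The explicit solution and its terminal value\<close>

lemma filterlim_inverse_bridge_scale_at_top:
  "filterlim (\<lambda>s. 1 / bridge_scale \<alpha> s) at_top (at_left 1)"
proof -
  have "(bridge_scale \<alpha> \<longlongrightarrow> bridge_scale \<alpha> 1) (at_left 1)"
    using bridge_scale_deriv[of \<alpha> 1] by (meson DERIV_isCont filterlim_at_split isCont_def)
  then have "filterlim (bridge_scale \<alpha>) (at_right 0) (at_left 1)"
    by (auto simp: filterlim_at eventually_at_left_field intro!: exI[of _ 0]
        dest!: bridge_scale_pos[of _ \<alpha>])
  then show ?thesis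
    using filterlim_compose[OF filterlim_inverse_at_top_right] by (simp add: inverse_eq_divide)
qed

text \<open>For \<open>y = h F + \<gamma> W\<close> with \<open>h\<close> the scale, the product
  rule with \<open>h' = - cosh\<close> and \<open>F' = f / h^2\<close> gives the equation, because
  \<open>f\<close> contains the contribution of \<open>\<gamma> W\<close> to the drift. At time 1,
  \<open>h F = F / (1 / h)\<close> is treated by l'Hospital's rule with denominator tending to
  infinity: the derivatives have quotient \<open>f / cosh\<close>, which tends to
  \<open>z - \<gamma> W 1\<close>.\<close>

lemma bridge_path_bridge_solution:
  assumes w: "continuous_on {t..1} w" and t: "t < 1"
  shows "bridge_path (bridge_drift \<alpha> z) \<gamma> z t x w (bridge_solution \<alpha> z \<gamma> t x w)"
proof -
  let ?y = "bridge_solution \<alpha> z \<gamma> t x w"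
  define W where "W u = w u - w t" for u
  define f where "f u = z - \<gamma> * cosh (\<alpha> * (1 - u)) * W u" for u
  define h where "h = bridge_scale \<alpha>"
  define F where "F s = x / h t + integral {t..s} (\<lambda>u. f u / (h u)\<^sup>2)" for s
  have h0: "0 < h u" if "u < 1" for u using bridge_scale_pos[OF that] by (simp add: h_def)
  have dh: "(h has_real_derivative - cosh (\<alpha> * (1 - u))) (at u)" for u
    using bridge_scale_deriv[of \<alpha>] by (simp add: h_def)
  have cf: "continuous_on {t..1} f" unfolding f_def W_def by (intro continuous_intros w)
  have ch: "continuous_on A h" for A unfolding h_def by (intro continuous_intros)
  have cI: "continuous_on {t..s} (\<lambda>u. f u / (h u)\<^sup>2)" if "s < 1" for s
  proof -
    have "h u \<noteq> 0" if "u \<in> {t..s}" for u using h0[of u] that \<open>s < 1\<close> by auto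
    then show ?thesis
      using that by (intro continuous_intros ch continuous_on_subset[OF cf]) auto
  qed
  have eq: "?y s = h s * F s + \<gamma> * W s" if "s < 1" for s
    using that by (simp add: bridge_solution_def h_def F_def f_def W_def)
  have Fd: "(F has_real_derivative f u / (h u)\<^sup>2) (at u within {t..s})" if "t \<le> u" "u \<le> s" "s < 1" for u s
    unfolding F_def by (rule derivative_eq_intros integral_has_real_derivative[OF cI] refl)+
      (use that in auto)
  have dY: "((\<lambda>s. h s * F s) has_real_derivative bridge_drift \<alpha> z u (?y u)) (at u within {t..s})"
    if "t \<le> u" "u \<le> s" "s < 1" for u s
  proof -
    have "h u \<noteq> 0" using h0[of u] that by auto
    then have "h u * (f u / (h u)\<^sup>2) + - cosh (\<alpha> * (1 - u)) * F u = bridge_drift \<alpha> z u (?y u)"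
      using that by (simp add: eq bridge_drift_def h_def[symmetric] f_def field_simps power2_eq_square)
    moreover have "((\<lambda>s. h s * F s) has_real_derivative
        - cosh (\<alpha> * (1 - u)) * F u + f u / (h u)\<^sup>2 * h u) (at u within {t..s})"
      using that by (intro DERIV_mult Fd has_field_derivative_at_within[OF dh])
    ultimately show ?thesis by (simp add: ac_simps)
  qed
  have cyl: "continuous_on {t..s} ?y" if "s < 1" for s
  proof -
    have "continuous_on {t..s} (\<lambda>s. h s * F s + \<gamma> * W s)"
      using that unfolding W_def
      by (intro continuous_intros continuous_on_subset[OF w]
         DERIV_continuous_on[of _ _ "\<lambda>u. bridge_drift \<alpha> z u (?y u)"] dY) auto
    then show ?thesis
      by (rule continuous_on_cong[THEN iffD1, rotated -1]) (use that in \<open>auto simp: eq\<close>)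
  qed
  have eqn: "?y s = x + integral {t..s} (\<lambda>u. bridge_drift \<alpha> z u (?y u)) + \<gamma> * (w s - w t)"
    if "t \<le> s" "s < 1" for s
  proof -
    have "((\<lambda>u. bridge_drift \<alpha> z u (?y u)) has_integral (h s * F s - h t * F t)) {t..s}"
      using that dY by (intro fundamental_theorem_of_calculus)
        (auto simp: has_real_derivative_iff_has_vector_derivative[symmetric])
    moreover have "h t * F t = x" using h0[OF t] by (simp add: F_def)
    ultimately show ?thesis using that by (simp add: eq W_def integral_unique)
  qed
  have lim: "(?y \<longlongrightarrow> z) (at_left 1)"
  proof -
    have ev: "eventually (\<lambda>s::real. t < s \<and> s < 1) (at_left 1)"
      using t by (auto simp: eventually_at_left_field)
    have "((\<lambda>s. F s / (1 / h s)) \<longlongrightarrow> z - \<gamma> * W 1) (at_left 1)"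
    proof (rule lhopital_left_at_top[where f' = "\<lambda>u. f u / (h u)\<^sup>2" and g' = "\<lambda>u. cosh (\<alpha> * (1 - u)) / (h u)\<^sup>2"])
      show "filterlim (\<lambda>s. 1 / h s) at_top (at_left 1)"
        unfolding h_def by (rule filterlim_inverse_bridge_scale_at_top)
      show "\<forall>\<^sub>F u in at_left 1. cosh (\<alpha> * (1 - u)) / (h u)\<^sup>2 \<noteq> 0"
        using ev by eventually_elim (use h0 in force)
      show "\<forall>\<^sub>F u in at_left 1. (F has_real_derivative f u / (h u)\<^sup>2) (at u)"
        using ev
      proof eventually_elim
        case (elim u)
        obtain s where "u < s" "s < 1" using elim dense by blast
        then show ?case using Fd[of u s] elim by (simp add: at_within_Icc_at)
      qed
      show "\<forall>\<^sub>F u in at_left 1. ((\<lambda>s. 1 / h s) has_real_derivative cosh (\<alpha> * (1 - u)) / (h u)\<^sup>2) (at u)"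
        using ev
      proof eventually_elim
        case (elim u)
        then have "h u \<noteq> 0" using h0[of u] by auto
        then show ?case
          by (auto intro!: derivative_eq_intros dh simp: power2_eq_square)
      qed
      have "((\<lambda>u. f u / cosh (\<alpha> * (1 - u))) \<longlongrightarrow> f 1 / cosh (\<alpha> * (1 - 1))) (at 1 within {t..1})"
        using t by (intro tendsto_intros cf[unfolded continuous_on, rule_format]) auto
      then have l: "((\<lambda>u. f u / cosh (\<alpha> * (1 - u))) \<longlongrightarrow> z - \<gamma> * W 1) (at_left 1)"
        using t by (simp add: at_within_Icc_at_left f_def)
      show "((\<lambda>u. f u / (h u)\<^sup>2 / (cosh (\<alpha> * (1 - u)) / (h u)\<^sup>2)) \<longlongrightarrow> z - \<gamma> * W 1) (at_left 1)"
        by (rule Lim_transform_eventually[OF l]) (use ev in eventually_elim, use h0 in force)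
    qed
    moreover have "(W \<longlongrightarrow> W 1) (at_left 1)"
    proof -
      have "continuous_on {t..1} W" unfolding W_def by (intro continuous_intros w)
      then show ?thesis using t by (auto simp: continuous_on at_within_Icc_at_left[symmetric])
    qed
    ultimately have "((\<lambda>s. F s / (1 / h s) + \<gamma> * W s) \<longlongrightarrow> (z - \<gamma> * W 1) + \<gamma> * W 1) (at_left 1)"
      by (intro tendsto_intros)
    then have "((\<lambda>s. F s / (1 / h s) + \<gamma> * W s) \<longlongrightarrow> z) (at_left 1)" by simp
    then show ?thesis
      by (rule Lim_transform_eventually) (use ev in eventually_elim, simp add: eq)
  qed
  have "continuous_on {t..1} ?y"
    unfolding continuous_on_eq_continuous_within
  proof
    fix s assume s: "s \<in> {t..1}"
    show "continuous (at s within {t..1}) ?y"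
    proof (cases "s = 1")
      case True
      then show ?thesis using lim t
        by (simp add: continuous_within at_within_Icc_at_left bridge_solution_def)
    next
      case False
      with s obtain r where r: "s < r" "r < 1" using dense[of s 1] by auto
      have "at s within {t..1} = at s within {t..r}"
        using r s by (intro at_within_nhd[of _ "{..<r}"]) auto
      then show ?thesis using cyl[OF r(2)] s r by (auto simp: continuous_on_eq_continuous_within)
    qed
  qed
  then show ?thesis using eqn by (auto simp: bridge_path_def bridge_solution_def)
qed

section \<open>Brownian motion and its filtration\<close>

lemma preimage_in_sets:
  "f \<in> N \<rightarrow>\<^sub>M L \<Longrightarrow> A \<in> sets L \<Longrightarrow> {\<omega> \<in> space N. f \<omega> \<in> A} \<in> sets N"
  using measurable_sets[of f N L A] by (simp add: vimage_def Int_def conj_commute)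

text \<open>Rounding \<open>T\<close> down to a grid leaves countably many values, where
  measurability at fixed times suffices; path continuity gives the limit. With \<open>N\<close> a
  product with Lebesgue measure and \<open>T\<close> depending on the time coordinate, the same
  lemma yields joint measurability.\<close>

lemma borel_measurable_at_random_time:
  fixes Z :: "real \<Rightarrow> 'b \<Rightarrow> real"
  assumes ab: "a \<le> b" and Z: "\<And>s. s \<in> {a..b} \<Longrightarrow> Z s \<in> borel_measurable N"
    and cont: "\<And>\<omega>. \<omega> \<in> space N \<Longrightarrow> continuous_on {a..b} (\<lambda>s. Z s \<omega>)"
    and T[measurable]: "T \<in> borel_measurable N" and T_in: "\<And>\<omega>. \<omega> \<in> space N \<Longrightarrow> T \<omega> \<in> {a..b}"
  shows "(\<lambda>\<omega>. Z (T \<omega>) \<omega>) \<in> borel_measurable N"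
proof -
  \<comment> \<open>Rounding down may fall below \<open>a\<close>; the clamp keeps all evaluation
    times in \<open>{a..b}\<close>.\<close>
  define p where "p n i = max a (min b (real_of_int i / real (Suc n)))" for n :: nat and i :: int
  define g where "g n \<omega> = \<lfloor>real (Suc n) * T \<omega>\<rfloor>" for n \<omega>
  have pin: "p n i \<in> {a..b}" for n i using ab by (auto simp: p_def)
  show ?thesis
  proof (rule borel_measurable_LIMSEQ_real)
    fix n
    have "g n \<in> N \<rightarrow>\<^sub>M count_space UNIV" unfolding g_def
      by (rule measurable_compose[OF _ measurable_real_floor]) (intro borel_measurable_times borel_measurable_const T)
    with Z[OF pin] show "(\<lambda>\<omega>. Z (p n (g n \<omega>)) \<omega>) \<in> borel_measurable N"
      by (rule measurable_compose_countable[where f = "\<lambda>i \<omega>. Z (p n i) \<omega>"])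
  next
    fix \<omega> assume \<omega>: "\<omega> \<in> space N"
    have "(\<lambda>n. real_of_int (g n \<omega>) / real (Suc n)) \<longlonglongrightarrow> T \<omega>"
    proof (rule LIMSEQ_I)
      fix e :: real assume "0 < e"
      then obtain m where m: "inverse (real (Suc m)) < e" using reals_Archimedean by blast
      have "norm (real_of_int (g n \<omega>) / real (Suc n) - T \<omega>) < e" if "m \<le> n" for n
      proof -
        have "real_of_int (g n \<omega>) \<le> real (Suc n) * T \<omega>" "real (Suc n) * T \<omega> < real_of_int (g n \<omega>) + 1"
          unfolding g_def by linarith+
        then have "T \<omega> \<le> (real_of_int (g n \<omega>) + 1) / real (Suc n)"
          "real_of_int (g n \<omega>) / real (Suc n) \<le> T \<omega>"
          by (simp_all add: pos_le_divide_eq pos_divide_le_eq mult.commute)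
        then have "T \<omega> - inverse (real (Suc n)) \<le> real_of_int (g n \<omega>) / real (Suc n)"
          "real_of_int (g n \<omega>) / real (Suc n) \<le> T \<omega>"
          by (simp_all add: add_divide_distrib inverse_eq_divide)
        moreover have "inverse (real (Suc n)) \<le> inverse (real (Suc m))"
          using that by (intro le_imp_inverse_le) auto
        ultimately show ?thesis using m unfolding real_norm_def by linarith
      qed
      then show "\<exists>no. \<forall>n\<ge>no. norm (real_of_int (g n \<omega>) / real (Suc n) - T \<omega>) < e" by blast
    qed
    then have "(\<lambda>n. p n (g n \<omega>)) \<longlonglongrightarrow> max a (min b (T \<omega>))"
      unfolding p_def by (intro tendsto_intros)
    also have "max a (min b (T \<omega>)) = T \<omega>" using T_in[OF \<omega>] by auto
    finally have "(\<lambda>n. p n (g n \<omega>)) \<longlonglongrightarrow> T \<omega>" .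
    then show "(\<lambda>n. Z (p n (g n \<omega>)) \<omega>) \<longlonglongrightarrow> Z (T \<omega>) \<omega>"
      by (rule continuous_on_tendsto_compose[OF cont[OF \<omega>]]) (use T_in[OF \<omega>] pin in auto)
  qed
qed

text \<open>The path equations use the gauge integral, Tonelli's theorem the Lebesgue integral; for
  continuous integrands they agree.\<close>

lemma ennreal_integral_Icc:
  fixes f :: "real \<Rightarrow> real"
  assumes "continuous_on {a..b} f" "\<And>u. u \<in> {a..b} \<Longrightarrow> 0 \<le> f u"
  shows "ennreal (integral {a..b} f) = (\<integral>\<^sup>+u. ennreal (indicator {a..b} u * f u) \<partial>lborel)"
proof -
  have i: "set_integrable lborel {a..b} f" by (rule borel_integrable_atLeastAtMost'[OF assms(1)])
  have "(\<integral>\<^sup>+u. ennreal (indicator {a..b} u * f u) \<partial>lborel) = ennreal (\<integral>u. indicator {a..b} u * f u \<partial>lborel)"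
    using i assms(2) by (intro nn_integral_eq_integral) (auto simp: set_integrable_def indicator_def)
  also have "(\<integral>u. indicator {a..b} u * f u \<partial>lborel) = integral {a..b} f"
    using set_borel_integral_eq_integral(2)[OF i] by (simp add: set_lebesgue_integral_def)
  finally show ?thesis by simp
qed

locale brownian_motion = prob_space M for M :: "'a measure" and B :: "real \<Rightarrow> 'a \<Rightarrow> real" +
  assumes bm: "standard_brownian_motion M B"
begin

lemma B_measurable: "0 \<le> t \<Longrightarrow> B t \<in> borel_measurable M"
  using bm by (auto simp: standard_brownian_motion_def)

lemma B_0: "AE \<omega> in M. B 0 \<omega> = 0"
  using bm by (auto simp: standard_brownian_motion_def)

lemma B_continuous: "\<omega> \<in> space M \<Longrightarrow> A \<subseteq> {0..} \<Longrightarrow> continuous_on A (\<lambda>t. B t \<omega>)"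
  using bm by (auto simp: standard_brownian_motion_def intro: continuous_on_subset)

lemma B_increment_distributed:
  "0 \<le> s \<Longrightarrow> s < t \<Longrightarrow> distributed M lborel (\<lambda>\<omega>. B t \<omega> - B s \<omega>) (normal_density 0 (sqrt (t - s)))"
  using bm by (auto simp: standard_brownian_motion_def)

lemma B_increments_indep:
  fixes t :: "nat \<Rightarrow> real"
  shows "0 \<le> t 0 \<Longrightarrow> (\<And>i. i < n \<Longrightarrow> t i < t (Suc i)) \<Longrightarrow>
    indep_vars (\<lambda>_. borel) (\<lambda>i \<omega>. B (t (Suc i)) \<omega> - B (t i) \<omega>) {..<n}"
  using bm by (auto simp: standard_brownian_motion_def)

lemma B_increment_moments:
  assumes "0 \<le> s" "s < t"
  shows "integrable M (\<lambda>\<omega>. B t \<omega> - B s \<omega>)" "expectation (\<lambda>\<omega>. B t \<omega> - B s \<omega>) = 0"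
    "integrable M (\<lambda>\<omega>. (B t \<omega> - B s \<omega>)\<^sup>2)" "expectation (\<lambda>\<omega>. (B t \<omega> - B s \<omega>)\<^sup>2) = t - s"
proof -
  note d = B_increment_distributed[OF assms]
  have p: "0 < sqrt (t - s)" using assms by simp
  show "integrable M (\<lambda>\<omega>. B t \<omega> - B s \<omega>)"
    using distributed_integrable[OF d, of "\<lambda>x. x"] integrable_normal_moment[OF p, of 0 1] by simp
  show "expectation (\<lambda>\<omega>. B t \<omega> - B s \<omega>) = 0"
    using distributed_integral[OF d, of "\<lambda>x. x"] integral_normal_moment_odd[OF p, of 0 0] by simp
  show "integrable M (\<lambda>\<omega>. (B t \<omega> - B s \<omega>)\<^sup>2)"
    using distributed_integrable[OF d, of "\<lambda>x. x\<^sup>2"] integrable_normal_moment[OF p, of 0 2] by simp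
  show "expectation (\<lambda>\<omega>. (B t \<omega> - B s \<omega>)\<^sup>2) = t - s"
    using distributed_integral[OF d, of "\<lambda>x. x\<^sup>2"] integral_normal_moment_even[OF p, of 0 1] assms
    by simp
qed

lemma nn_integral_B_increment_square:
  assumes "0 \<le> s" "s \<le> t"
  shows "(\<integral>\<^sup>+\<omega>. ennreal ((B t \<omega> - B s \<omega>)\<^sup>2) \<partial>M) = ennreal (t - s)"
proof (cases "s = t")
  case False
  with assms B_increment_moments[of s t] show ?thesis by (subst nn_integral_eq_integral) auto
qed simp

section \<open>The natural filtration and independence of later increments\<close>

abbreviation F :: "real \<Rightarrow> 'a measure" where "F \<equiv> natural_filtration M B"

lemma space_F [simp]: "space (F s) = space M"
  by (simp add: natural_filtration_def space_measure_of_conv)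

lemma sets_F: "sets (F s) = sigma_sets (space M) {B u -` A \<inter> space M | u A. 0 \<le> u \<and> u \<le> s \<and> A \<in> sets borel}"
  unfolding natural_filtration_def by (rule sets_measure_of) auto

lemma sets_F_events: "sets (F s) \<subseteq> events"
  unfolding sets_F by (rule sets.sigma_sets_subset) (auto intro: measurable_sets B_measurable)

lemma sets_F_mono: "s \<le> s' \<Longrightarrow> sets (F s) \<subseteq> sets (F s')"
  unfolding sets_F by (rule sigma_sets_mono') force

lemma borel_measurable_F: "X \<in> borel_measurable (F s) \<Longrightarrow> X \<in> borel_measurable M"
  using sets_F_events[of s] by (auto simp: measurable_def)

lemma borel_measurable_F_mono: "X \<in> borel_measurable (F s) \<Longrightarrow> s \<le> s' \<Longrightarrow> X \<in> borel_measurable (F s')"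
  using sets_F_mono[of s s'] by (auto simp: measurable_def)

lemma B_measurable_F: "0 \<le> u \<Longrightarrow> u \<le> s \<Longrightarrow> B u \<in> borel_measurable (F s)"
  by (rule measurableI) (auto simp: sets_F)

lemma stopping_time_measurable: "stopping_time F T \<Longrightarrow> T \<in> borel_measurable M"
  by (rule measurable_stopping_time[of F]) (use sets_F_events in auto)

text \<open>Independence is given for consecutive increments along a strictly increasing grid.
  Sorting \<open>J\<close> together with \<open>0\<close> and \<open>s\<close> and appending
  \<open>t\<close> makes such a grid: \<open>B u - B 0\<close> is a partial sum of the increments up
  to \<open>s\<close>, and the last increment is \<open>B t - B s\<close>.\<close>

lemma cylinder_indep_increment:
  assumes J: "finite J" "J \<subseteq> {0..s}" and st: "0 \<le> s" "s < t"
    and A: "\<And>u. u \<in> J \<Longrightarrow> A u \<in> sets borel" and D: "D \<in> sets borel"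
  shows "prob ({\<omega> \<in> space M. \<forall>u\<in>J. B u \<omega> \<in> A u} \<inter> {\<omega> \<in> space M. B t \<omega> - B s \<omega> \<in> D}) =
    prob {\<omega> \<in> space M. \<forall>u\<in>J. B u \<omega> \<in> A u} * prob {\<omega> \<in> space M. B t \<omega> - B s \<omega> \<in> D}"
proof -
  note [measurable] = B_measurable A D
  have "finite (insert 0 (insert s J))" using J by simp
  from ex1_implies_ex[OF ex1_sorted_list_for_set_if_finite[OF this]]
  obtain l where "sorted_wrt (<) l \<and> set l = insert 0 (insert s J)" by (rule exE)
  then have setl: "set l = insert 0 (insert s J)" and strict: "sorted_wrt (<) l" by auto
  have sl: "\<And>i j. i < j \<Longrightarrow> j < length l \<Longrightarrow> l ! i < l ! j"
    using strict by (simp add: sorted_wrt_iff_nth_less)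
  define n where "n = length l - 1"
  have len: "length l = Suc n" using setl by (cases l) (auto simp: n_def)
  have l0: "l ! 0 = 0"
  proof -
    obtain i where i: "i < length l" "l ! i = 0" using setl by (metis in_set_conv_nth insertI1)
    have "l ! 0 \<in> set l" using len by simp
    then have "0 \<le> l ! 0" using J st setl by auto
    then show ?thesis using sl[of 0 i] i by (cases "i = 0") auto
  qed
  have ln: "l ! n = s"
  proof -
    obtain i where i: "i < length l" "l ! i = s" using setl by (metis in_set_conv_nth insertI1 insertI2)
    have "l ! n \<in> set l" using len by simp
    then have "l ! n \<le> s" using J st setl by auto
    then show ?thesis using sl[of i n] i len by (cases "i = n") auto
  qed
  \<comment> \<open>Indices up to \<open>n\<close> run through the sorted list, which ends in
    \<open>s\<close>; index \<open>Suc n\<close> is \<open>t\<close>. Increment number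
    \<open>n\<close> is therefore the one from \<open>s\<close> to \<open>t\<close>.\<close>
  define r where "r i = (if i \<le> n then l ! i else t)" for i
  have rS: "r i < r (Suc i)" if "i < Suc n" for i
    using sl[of i "Suc i"] that len ln st by (cases "i = n") (auto simp: r_def)
  have r0: "r 0 = 0" by (simp add: r_def l0)
  define X where "X i \<omega> = B (r (Suc i)) \<omega> - B (r i) \<omega>" for i \<omega>
  have ind: "indep_vars (\<lambda>_. borel) X {..<Suc n}"
    unfolding X_def using r0 rS by (intro B_increments_indep) auto
  define idx where "idx u = (SOME i. i \<le> n \<and> r i = u)" for u
  have idx: "idx u \<le> n \<and> r (idx u) = u" if "u \<in> J" for u
  proof -
    have "u \<in> set l" using that setl by auto
    then obtain i where "i < length l" "l ! i = u" by (auto simp: in_set_conv_nth)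
    then have "i \<le> n \<and> r i = u" using len by (auto simp: r_def)
    then show ?thesis unfolding idx_def by (rule someI)
  qed
  define S where "S = {f \<in> space (PiM {..<n} (\<lambda>_. borel)). \<forall>u\<in>J. (\<Sum>k<idx u. f k) \<in> A u}"
  define E where "E = {f \<in> space (PiM {n} (\<lambda>_. borel)). f n \<in> D}"
  have S: "S \<in> sets (PiM {..<n} (\<lambda>_. borel :: real measure))"
  proof -
    have "(\<lambda>f. \<Sum>k<idx u. f k) \<in> borel_measurable (PiM {..<n} (\<lambda>_. borel :: real measure))" if "u \<in> J" for u
      using idx[OF that] by (intro borel_measurable_sum measurable_component_singleton) auto
    then show ?thesis unfolding S_def
      using J A by (intro sets.sets_Collect_finite_All preimage_in_sets[where L = borel]) auto
  qed
  have E: "E \<in> sets (PiM {n} (\<lambda>_. borel :: real measure))" unfolding E_def by measurable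
  define S' where "S' = {\<omega> \<in> space M. \<forall>u\<in>J. B u \<omega> - B 0 \<omega> \<in> A u}"
  have sum: "(\<Sum>k<idx u. X k \<omega>) = B u \<omega> - B 0 \<omega>" if "u \<in> J" for u \<omega>
    using sum_lessThan_telescope[of "\<lambda>k. B (r k) \<omega>" "idx u"] idx[OF that] r0 by (simp add: X_def)
  have S'_eq: "(\<lambda>\<omega>. restrict (\<lambda>i. X i \<omega>) {..<n}) -` S \<inter> space M = S'"
  proof -
    have "(\<Sum>k<idx u. restrict (\<lambda>i. X i \<omega>) {..<n} k) = (\<Sum>k<idx u. X k \<omega>)" if "u \<in> J" for u \<omega>
      using idx[OF that] by (intro sum.cong) auto
    then show ?thesis by (auto simp: S_def S'_def space_PiM sum)
  qed
  have rn: "r n = s" "r (Suc n) = t" using ln by (auto simp: r_def)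
  have E_eq: "(\<lambda>\<omega>. restrict (\<lambda>i. X i \<omega>) {n}) -` E \<inter> space M = {\<omega> \<in> space M. B t \<omega> - B s \<omega> \<in> D}"
    by (auto simp: E_def space_PiM X_def rn)
  have "indep_var (PiM {..<n} (\<lambda>_. borel)) (\<lambda>\<omega>. restrict (\<lambda>i. X i \<omega>) {..<n})
      (PiM {n} (\<lambda>_. borel)) (\<lambda>\<omega>. restrict (\<lambda>i. X i \<omega>) {n})"
    by (rule indep_var_restrict[OF ind]) auto
  from indep_varD[OF this S E]
  have prod: "prob (S' \<inter> {\<omega> \<in> space M. B t \<omega> - B s \<omega> \<in> D}) = prob S' * prob {\<omega> \<in> space M. B t \<omega> - B s \<omega> \<in> D}"
    unfolding S'_eq[symmetric] E_eq[symmetric]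
    by (simp only: vimage_def Int_def mem_Times_iff fst_conv snd_conv mem_Collect_eq conj_ac conj_left_absorb)
  have J0: "0 \<le> u" if "u \<in> J" for u using that J by auto
  have m1: "{\<omega> \<in> space M. \<forall>u\<in>J. B u \<omega> \<in> A u} \<in> events"
    using J(1) J0 A by (intro sets.sets_Collect_finite_All preimage_in_sets[OF B_measurable]) auto
  have m2: "S' \<in> events" unfolding S'_def
    using J(1) J0 A
    by (intro sets.sets_Collect_finite_All preimage_in_sets[OF borel_measurable_diff] B_measurable) auto
  have m3: "{\<omega> \<in> space M. B t \<omega> - B s \<omega> \<in> D} \<in> events"
    using st D by (intro preimage_in_sets[OF borel_measurable_diff] B_measurable) auto
  \<comment> \<open>Subtracting \<open>B 0\<close> changes the cylinder event by a null set only, as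
    \<open>B 0 = 0\<close> almost surely.\<close>
  have "prob {\<omega> \<in> space M. \<forall>u\<in>J. B u \<omega> \<in> A u} = prob S'"
    by (rule finite_measure_eq_AE[OF _ m1 m2]) (use B_0 in \<open>auto simp: S'_def\<close>)
  moreover have "prob ({\<omega> \<in> space M. \<forall>u\<in>J. B u \<omega> \<in> A u} \<inter> {\<omega> \<in> space M. B t \<omega> - B s \<omega> \<in> D})
      = prob (S' \<inter> {\<omega> \<in> space M. B t \<omega> - B s \<omega> \<in> D})"
    by (rule finite_measure_eq_AE) (use B_0 m1 m2 m3 in \<open>auto simp: S'_def\<close>)
  ultimately show ?thesis using prod by simp
qed

text \<open>Cylinder sets at times up to \<open>s\<close> are closed under intersection and generate
  the filtration at \<open>s\<close>, so independence extends from them to every measurable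
  \<open>X\<close>.\<close>

lemma F_indep_increment:
  assumes st: "0 \<le> s" "s < t" and X: "X \<in> borel_measurable (F s)"
  shows "indep_var borel X borel (\<lambda>\<omega>. B t \<omega> - B s \<omega>)"
proof -
  note [measurable] = B_measurable
  define C where "C = {{\<omega> \<in> space M. \<forall>u\<in>J. B u \<omega> \<in> A u} | J A. finite J \<and> J \<subseteq> {0..s} \<and> (\<forall>u\<in>J. A u \<in> sets borel)}"
  define E where "E = {{\<omega> \<in> space M. B t \<omega> - B s \<omega> \<in> D} | D. D \<in> sets (borel :: real measure)}"
  have E_alt: "E = {(\<lambda>\<omega>. B t \<omega> - B s \<omega>) -` D \<inter> space M | D. D \<in> sets borel}"
  proof -
    have "{\<omega> \<in> space M. B t \<omega> - B s \<omega> \<in> D} = (\<lambda>\<omega>. B t \<omega> - B s \<omega>) -` D \<inter> space M" for D by auto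
    then show ?thesis unfolding E_def by simp
  qed
  have Cev: "C \<subseteq> events"
  proof
    fix c assume "c \<in> C"
    then obtain J A where c: "c = {\<omega> \<in> space M. \<forall>u\<in>J. B u \<omega> \<in> A u}" "finite J" "J \<subseteq> {0..s}"
      "\<forall>u\<in>J. A u \<in> sets borel" by (auto simp: C_def)
    have "{\<omega> \<in> space M. B u \<omega> \<in> A u} \<in> events" if "u \<in> J" for u
      using that c by (intro preimage_in_sets[OF B_measurable]) auto
    then show "c \<in> events" unfolding c(1) using c(2)
      by (rule sets.sets_Collect_finite_All)
  qed
  have "indep_set C E"
  proof (rule indep_setI[OF Cev])
    show "E \<subseteq> events" unfolding E_alt using st by (auto intro!: measurable_sets[OF borel_measurable_diff] B_measurable)
    fix a b assume "a \<in> C" "b \<in> E"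
    then show "prob (a \<inter> b) = prob a * prob b"
      unfolding C_def E_def using cylinder_indep_increment[OF _ _ st] by blast
  qed
  moreover have "Int_stable C"
  proof (rule Int_stableI)
    fix a b assume "a \<in> C" "b \<in> C"
    then obtain J A J' A' where
      a: "a = {\<omega> \<in> space M. \<forall>u\<in>J. B u \<omega> \<in> A u}" "finite J" "J \<subseteq> {0..s}" "\<forall>u\<in>J. A u \<in> sets borel" and
      b: "b = {\<omega> \<in> space M. \<forall>u\<in>J'. B u \<omega> \<in> A' u}" "finite J'" "J' \<subseteq> {0..s}" "\<forall>u\<in>J'. A' u \<in> sets borel"
      unfolding C_def by blast
    \<comment> \<open>A time constrained by only one cylinder receives \<open>UNIV\<close> from the
      other, so the intersection is a cylinder over \<open>J \<union> J'\<close>.\<close>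
    let ?A = "\<lambda>u. (if u \<in> J then A u else UNIV) \<inter> (if u \<in> J' then A' u else UNIV)"
    have "a \<inter> b = {\<omega> \<in> space M. \<forall>u\<in>J \<union> J'. B u \<omega> \<in> ?A u}"
      unfolding a(1) b(1) by auto
    moreover have "finite (J \<union> J') \<and> J \<union> J' \<subseteq> {0..s} \<and> (\<forall>u\<in>J \<union> J'. ?A u \<in> sets borel)"
      using a b by auto
    ultimately show "a \<inter> b \<in> C" unfolding C_def
      by (intro CollectI exI[of _ "J \<union> J'"] exI[of _ ?A] conjI) simp_all
  qed
  moreover have "Int_stable E"
  proof (rule Int_stableI)
    fix a b assume "a \<in> E" "b \<in> E"
    then obtain D D' where "a = {\<omega> \<in> space M. B t \<omega> - B s \<omega> \<in> D}" "D \<in> sets borel"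
      "b = {\<omega> \<in> space M. B t \<omega> - B s \<omega> \<in> D'}" "D' \<in> sets borel" unfolding E_def by blast
    then have "a \<inter> b = {\<omega> \<in> space M. B t \<omega> - B s \<omega> \<in> D \<inter> D'}" "D \<inter> D' \<in> sets borel" by auto
    then show "a \<inter> b \<in> E" unfolding E_def by blast
  qed
  ultimately have ind: "indep_set (sigma_sets (space M) C) (sigma_sets (space M) E)"
    by (rule indep_set_sigma_sets)
  have FC: "sets (F s) \<subseteq> sigma_sets (space M) C"
    unfolding sets_F
  proof (rule sigma_sets_mono, safe)
    fix u and A :: "real set" assume "0 \<le> u" "u \<le> s" "A \<in> sets borel"
    then have "{\<omega> \<in> space M. \<forall>v\<in>{u}. B v \<omega> \<in> (\<lambda>_. A) v} \<in> C" unfolding C_def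
      by (intro CollectI exI[of _ "{u}"] exI[of _ "\<lambda>_. A"]) auto
    moreover have "{\<omega> \<in> space M. \<forall>v\<in>{u}. B v \<omega> \<in> (\<lambda>_. A) v} = B u -` A \<inter> space M" by auto
    ultimately show "B u -` A \<inter> space M \<in> sigma_sets (space M) C" by (auto intro: sigma_sets.Basic)
  qed
  have "sigma_sets (space M) {X -` A \<inter> space M | A. A \<in> sets borel} \<subseteq> sets (F s)"
    using sets.sigma_sets_subset[of "{X -` A \<inter> space M | A. A \<in> sets borel}" "F s"]
      measurable_sets[OF X] by auto
  then have "sigma_sets (space M) {X -` A \<inter> space M | A. A \<in> sets borel} \<subseteq> sigma_sets (space M) C"
    using FC by blast
  then have "indep_set (sigma_sets (space M) {X -` A \<inter> space M | A. A \<in> sets borel}) (sigma_sets (space M) E)"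
    using ind unfolding indep_set_def
    by (elim indep_sets_mono_sets) (auto split: bool.split)
  then show ?thesis
    unfolding indep_var_eq E_alt using st borel_measurable_F[OF X] by auto
qed

end

section \<open>Stopped second moments\<close>

text \<open>The pinned estimate combined with \<open>|c| \<le> 1 + c^2\<close>. Extending its time
  integral from \<open>s\<close> to 1 makes it independent of \<open>s\<close>, so that a stopping
  time can be inserted for \<open>s\<close>. The bound is stated in the extended reals because this
  integral may diverge along a single path.\<close>

lemma brownian_bridge_path_abs_bound:
  assumes y: "bridge_path (bridge_drift 0 z) \<gamma> z t x w y"
    and w: "continuous_on {t..1} w" and ts: "t \<le> s" "s \<le> 1" "t < 1"
  shows "ennreal \<bar>y s\<bar> \<le> ennreal (\<bar>z\<bar> + 2 + 2 * (x - z)\<^sup>2 + 4 * \<gamma>\<^sup>2) *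
    (1 + (ennreal ((w s - w t)\<^sup>2) + (ennreal ((w 1 - w t)\<^sup>2) +
      (\<integral>\<^sup>+u. ennreal (indicator {t..<1} u * ((w u - w 1)\<^sup>2 / (1 - u))) \<partial>lborel))))"
    (is "_ \<le> ennreal ?C * (1 + (_ + (_ + ?J)))")
proof (cases "s = 1")
  case True
  have "\<bar>y s\<bar> \<le> ?C" using y True by (simp add: bridge_path_def)
  then have "ennreal \<bar>y s\<bar> \<le> ennreal ?C * 1" unfolding mult_1_right by (rule ennreal_leI)
  also have "\<dots> \<le> ennreal ?C * (1 + (ennreal ((w s - w t)\<^sup>2) + (ennreal ((w 1 - w t)\<^sup>2) + ?J)))"
    by (intro mult_left_mono) auto
  finally show ?thesis .
next
  case False
  with ts have s: "s < 1" by simp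
  define I where "I = integral {t..s} (\<lambda>u. (w u - w 1)\<^sup>2 / (1 - u))"
  have cw: "continuous_on {t..s} w" by (rule continuous_on_subset[OF w]) (use s in auto)
  have cI: "continuous_on {t..s} (\<lambda>u. (w u - w 1)\<^sup>2 / (1 - u))"
    by (intro continuous_intros cw) (use s in auto)
  have I0: "0 \<le> I" unfolding I_def
    by (rule Henstock_Kurzweil_Integration.integral_nonneg)
       (use s in \<open>auto intro!: integrable_continuous_interval cI\<close>)
  have IJ: "ennreal I \<le> ?J"
  proof -
    have "ennreal I = (\<integral>\<^sup>+u. ennreal (indicator {t..s} u * ((w u - w 1)\<^sup>2 / (1 - u))) \<partial>lborel)"
      unfolding I_def by (rule ennreal_integral_Icc[OF cI]) (use s in auto)
    also have "\<dots> \<le> ?J"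
      by (intro nn_integral_mono ennreal_leI) (use s in \<open>auto simp: indicator_def\<close>)
    finally show ?thesis .
  qed
  define a where "a = w s - w t"
  define b where "b = w 1 - w t"
  define q where "q = y s - z - \<gamma> * (w s - w 1)"
  have ab: "\<bar>c\<bar> \<le> 1 + c\<^sup>2" for c :: real
  proof -
    have "0 \<le> (\<bar>c\<bar> - 1)\<^sup>2" by simp
    then show ?thesis by (simp add: power2_diff)
  qed
  have sq: "(c - d)\<^sup>2 \<le> 2 * c\<^sup>2 + 2 * d\<^sup>2" for c d :: real
    using zero_le_power2[of "c + d"] by (simp add: power2_sum power2_diff)
  have q: "q\<^sup>2 \<le> (x - z - \<gamma> * (- b))\<^sup>2 + \<gamma>\<^sup>2 * I"
    using brownian_bridge_path_pinned_bound[OF y w ts(1) s] by (simp add: q_def I_def b_def)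
  have "y s = z + \<gamma> * (a - b) + q" by (simp add: q_def a_def b_def)
  then have "\<bar>y s\<bar> \<le> \<bar>z\<bar> + \<bar>\<gamma> * (a - b)\<bar> + \<bar>q\<bar>" by linarith
  also have "\<dots> \<le> \<bar>z\<bar> + (1 + (\<gamma> * (a - b))\<^sup>2) + (1 + q\<^sup>2)" by (intro add_mono ab) simp
  also have "(\<gamma> * (a - b))\<^sup>2 \<le> \<gamma>\<^sup>2 * (2 * a\<^sup>2 + 2 * b\<^sup>2)"
    unfolding power_mult_distrib by (intro mult_left_mono sq) simp
  also have "q\<^sup>2 \<le> (2 * (x - z)\<^sup>2 + 2 * (\<gamma>\<^sup>2 * b\<^sup>2)) + \<gamma>\<^sup>2 * I"
    using q sq[of "x - z" "\<gamma> * (- b)"] by (simp add: power_mult_distrib)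
  \<comment> \<open>The weight 4 of \<open>\<gamma>^2 b^2\<close> is made of 2 from the square of
    \<open>\<gamma> (a - b)\<close> and 2 from the initial term of the pinned estimate.\<close>
  also have "\<bar>z\<bar> + (1 + \<gamma>\<^sup>2 * (2 * a\<^sup>2 + 2 * b\<^sup>2)) + (1 + ((2 * (x - z)\<^sup>2 + 2 * (\<gamma>\<^sup>2 * b\<^sup>2)) + \<gamma>\<^sup>2 * I))
      = (\<bar>z\<bar> + 2 + 2 * (x - z)\<^sup>2) * 1 + 2 * \<gamma>\<^sup>2 * a\<^sup>2 + 4 * \<gamma>\<^sup>2 * b\<^sup>2 + \<gamma>\<^sup>2 * I"
    by (simp add: algebra_simps)
  also have "\<dots> \<le> ?C * 1 + ?C * a\<^sup>2 + ?C * b\<^sup>2 + ?C * I"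
  proof -
    have "\<bar>z\<bar> + 2 + 2 * (x - z)\<^sup>2 \<le> ?C" "2 * \<gamma>\<^sup>2 \<le> ?C" "4 * \<gamma>\<^sup>2 \<le> ?C" "\<gamma>\<^sup>2 \<le> ?C"
      using zero_le_power2[of \<gamma>] zero_le_power2[of "x - z"] by (simp_all add: add_nonneg_nonneg)
    note m = mult_right_mono[OF this(1) zero_le_one] mult_right_mono[OF this(2) zero_le_power2[of a]]
      mult_right_mono[OF this(3) zero_le_power2[of b]] mult_right_mono[OF this(4) I0]
    show ?thesis by (rule add_mono[OF add_mono[OF add_mono[OF m(1,2)] m(3)] m(4)])
  qed
  finally have "\<bar>y s\<bar> \<le> ?C * (1 + (a\<^sup>2 + (b\<^sup>2 + I)))" by (simp add: algebra_simps)
  then have "ennreal \<bar>y s\<bar> \<le> ennreal (?C * (1 + (a\<^sup>2 + (b\<^sup>2 + I))))" by (rule ennreal_leI)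
  also have "\<dots> = ennreal ?C * (1 + (ennreal (a\<^sup>2) + (ennreal (b\<^sup>2) + ennreal I)))"
    using I0 by (subst ennreal_mult) auto
  also have "\<dots> \<le> ennreal ?C * (1 + (ennreal (a\<^sup>2) + (ennreal (b\<^sup>2) + ?J)))"
    by (intro mult_left_mono add_left_mono IJ) auto
  finally show ?thesis by (simp add: a_def b_def)
qed

context brownian_motion
begin

text \<open>A discrete Ito isometry. The event \<open>r k < T\<close> belongs to
  \<open>F (r k)\<close>, so it and the sum so far are independent of the next increment: the mixed
  term has mean zero, and the squared term contributes probability times step length. Measurability
  and integrability are part of the claim because the next induction step uses them.\<close>

lemma stopped_sum_second_moment:
  fixes r :: "nat \<Rightarrow> real"
  assumes r0: "0 \<le> r 0" and r: "\<And>k. r k < r (Suc k)" and T: "stopping_time F T"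
  defines "S \<equiv> \<lambda>m \<omega>. \<Sum>k<m. (if r k < T \<omega> then B (r (Suc k)) \<omega> - B (r k) \<omega> else 0)"
  shows "S m \<in> borel_measurable (F (r m)) \<and> integrable M (\<lambda>\<omega>. (S m \<omega>)\<^sup>2) \<and>
    expectation (\<lambda>\<omega>. (S m \<omega>)\<^sup>2) = (\<Sum>k<m. expectation (\<lambda>\<omega>. of_bool (r k < T \<omega>)) * (r (Suc k) - r k))"
proof (induction m)
  case 0
  then show ?case by (simp add: S_def)
next
  case (Suc m)
  have rpos: "0 \<le> r k" for k
    by (induction k) (use r0 r less_imp_le order_trans in blast)+
  define I where "I \<omega> = (of_bool (r m < T \<omega>) :: real)" for \<omega>
  define D where "D \<omega> = B (r (Suc m)) \<omega> - B (r m) \<omega>" for \<omega>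
  have Smeas: "S m \<in> borel_measurable (F (r m))" and Sint: "integrable M (\<lambda>\<omega>. (S m \<omega>)\<^sup>2)"
    using Suc by auto
  have Imeas: "I \<in> borel_measurable (F (r m))"
  proof -
    have [measurable]: "Measurable.pred (F (r m)) (\<lambda>\<omega>. r m < T \<omega>)" by (rule stopping_timeD2[OF T])
    show ?thesis unfolding I_def by measurable
  qed
  have IS: "(\<lambda>\<omega>. S m \<omega> * I \<omega>) \<in> borel_measurable (F (r m))"
    by (intro borel_measurable_times Smeas Imeas)
  have Suc_eq: "S (Suc m) \<omega> = S m \<omega> + I \<omega> * D \<omega>" for \<omega>
    by (simp add: S_def I_def D_def)
  have mS: "S m \<in> borel_measurable M" and mI: "I \<in> borel_measurable M"
    using borel_measurable_F Smeas Imeas by auto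
  have iSI: "integrable M (\<lambda>\<omega>. S m \<omega> * I \<omega>)"
  proof (rule Bochner_Integration.integrable_bound[of _ "\<lambda>\<omega>. 1 + (S m \<omega>)\<^sup>2"])
    have "\<bar>c\<bar> \<le> 1 + c\<^sup>2" for c :: real
    proof -
      have "0 \<le> (\<bar>c\<bar> - 1)\<^sup>2" by simp
      then show ?thesis by (simp add: power2_diff)
    qed
    then show "AE \<omega> in M. norm (S m \<omega> * I \<omega>) \<le> norm (1 + (S m \<omega>)\<^sup>2)"
      by (auto simp: I_def abs_mult abs_of_nonneg)
  qed (use Sint mS mI in auto)
  have iI: "integrable M I"
    by (rule integrable_const_bound[of _ 1]) (use mI in \<open>auto simp: I_def\<close>)
  have mom: "integrable M D" "expectation D = 0" "integrable M (\<lambda>\<omega>. (D \<omega>)\<^sup>2)"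
    "expectation (\<lambda>\<omega>. (D \<omega>)\<^sup>2) = r (Suc m) - r m"
    using B_increment_moments[OF rpos r, of m] by (simp_all add: D_def[abs_def])
  have ind1: "indep_var borel (\<lambda>\<omega>. S m \<omega> * I \<omega>) borel D"
    unfolding D_def by (rule F_indep_increment[OF rpos r IS])
  have "indep_var borel I borel D"
    unfolding D_def by (rule F_indep_increment[OF rpos r Imeas])
  then have "indep_var borel ((\<lambda>x. x) \<circ> I) borel ((\<lambda>x. x\<^sup>2) \<circ> D)"
    by (rule indep_var_compose) auto
  then have ind2: "indep_var borel I borel (\<lambda>\<omega>. (D \<omega>)\<^sup>2)" by (simp add: comp_def)
  note e1 = indep_var_lebesgue_integral[OF ind1 iSI mom(1)] indep_var_integrable[OF ind1 iSI mom(1)]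
  note e2 = indep_var_lebesgue_integral[OF ind2 iI mom(3)] indep_var_integrable[OF ind2 iI mom(3)]
  \<comment> \<open>The indicator equals its own square, so \<open>I\<close> appears to the first
    power in the last term.\<close>
  have sq: "(S (Suc m) \<omega>)\<^sup>2 = (S m \<omega>)\<^sup>2 + 2 * (S m \<omega> * I \<omega> * D \<omega>) + I \<omega> * (D \<omega>)\<^sup>2" for \<omega>
    unfolding Suc_eq by (simp add: I_def power2_sum)
  have "S (Suc m) \<in> borel_measurable (F (r (Suc m)))"
    unfolding Suc_eq D_def
    by (intro borel_measurable_add borel_measurable_times borel_measurable_diff
        borel_measurable_F_mono[OF Smeas] borel_measurable_F_mono[OF Imeas] B_measurable_F
        less_imp_le[OF r] rpos) auto
  moreover have "integrable M (\<lambda>\<omega>. (S (Suc m) \<omega>)\<^sup>2)"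
    unfolding sq using Sint e1 e2 by auto
  moreover have "expectation (\<lambda>\<omega>. (S (Suc m) \<omega>)\<^sup>2)
      = expectation (\<lambda>\<omega>. (S m \<omega>)\<^sup>2) + expectation I * (r (Suc m) - r m)"
    unfolding sq using Sint e1 e2 mom by simp
  ultimately show ?case using Suc by (simp add: I_def[abs_def])
qed

text \<open>Optional stopping for \<open>B\<^sup>2 - s\<close>, by approximating the stopping time from above on a grid;
  Fatou's lemma gives only an inequality, which suffices.\<close>
lemma stopped_second_moment_le:
  assumes t: "0 \<le> t" "t < 1" and T: "stopping_time F T"
    and T_in: "\<And>\<omega>. \<omega> \<in> space M \<Longrightarrow> T \<omega> \<in> {t..1}"
  shows "(\<integral>\<^sup>+\<omega>. ennreal ((B (T \<omega>) \<omega> - B t \<omega>)\<^sup>2) \<partial>M) \<le> (\<integral>\<^sup>+\<omega>. ennreal (T \<omega> - t) \<partial>M)"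
proof -
  define d where "d n = (1 - t) / real (Suc n)" for n
  define r where "r n k = t + real k * d n" for n k
  \<comment> \<open>This counts the grid points strictly before \<open>T\<close>, so
    \<open>r n (N n \<omega>)\<close> is the first grid point at or after
    \<open>T \<omega>\<close>.\<close>
  define N where "N n \<omega> = nat \<lceil>(T \<omega> - t) / d n\<rceil>" for n \<omega>
  define S where "S n \<omega> = (\<Sum>k<Suc n. if r n k < T \<omega> then B (r n (Suc k)) \<omega> - B (r n k) \<omega> else 0)" for n \<omega>
  have d: "0 < d n" for n using t by (simp add: d_def)
  have [measurable]: "T \<in> borel_measurable M" by (rule stopping_time_measurable[OF T])
  have iT: "integrable M (\<lambda>\<omega>. T \<omega> - t)"
  proof (rule integrable_const_bound[of _ 1])
    show "AE \<omega> in M. norm (T \<omega> - t) \<le> 1" using T_in t by (intro AE_I2) force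
  qed measurable
  have kN: "r n k < T \<omega> \<longleftrightarrow> k < N n \<omega>" for n k \<omega>
  proof -
    have "r n k < T \<omega> \<longleftrightarrow> real k < (T \<omega> - t) / d n"
      using d[of n] by (auto simp: r_def pos_less_divide_eq)
    also have "\<dots> \<longleftrightarrow> k < N n \<omega>" unfolding N_def by linarith
    finally show ?thesis .
  qed
  have NS: "N n \<omega> \<le> Suc n" if "\<omega> \<in> space M" for n \<omega>
  proof -
    \<comment> \<open>The grid point of index \<open>Suc n\<close> is exactly 1, the largest
      possible value of \<open>T\<close>.\<close>
    have "\<not> r n (Suc n) < T \<omega>" using T_in[OF that] by (simp add: r_def d_def)
    then show ?thesis unfolding kN by simp
  qed
  have trunc: "(\<Sum>k<Suc n. if r n k < T \<omega> then f k else 0) = (\<Sum>k<N n \<omega>. f k)"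
    if "\<omega> \<in> space M" for n \<omega> and f :: "nat \<Rightarrow> real"
  proof -
    have "(\<Sum>k<N n \<omega>. f k) = (\<Sum>k<N n \<omega>. if r n k < T \<omega> then f k else 0)"
      by (intro sum.cong) (auto simp: kN)
    also have "\<dots> = (\<Sum>k<Suc n. if r n k < T \<omega> then f k else 0)"
      using NS[OF that, of n] by (intro sum.mono_neutral_left) (auto simp: kN)
    finally show ?thesis by simp
  qed
  have S_eq: "S n \<omega> = B (r n (N n \<omega>)) \<omega> - B t \<omega>" if "\<omega> \<in> space M" for n \<omega>
    unfolding S_def trunc[OF that] using sum_lessThan_telescope[of "\<lambda>k. B (r n k) \<omega>" "N n \<omega>"]
    by (simp add: r_def)
  have rN: "T \<omega> \<le> r n (N n \<omega>)" "r n (N n \<omega>) \<le> T \<omega> + d n" if "\<omega> \<in> space M" for n \<omega>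
  proof -
    have "\<not> r n (N n \<omega>) < T \<omega>" unfolding kN by simp
    then show "T \<omega> \<le> r n (N n \<omega>)" by simp
    have "0 \<le> (T \<omega> - t) / d n" using T_in[OF that] d[of n] by auto
    then have "real (N n \<omega>) \<le> (T \<omega> - t) / d n + 1" unfolding N_def by linarith
    then have "real (N n \<omega>) * d n \<le> T \<omega> - t + d n"
      using d[of n] by (simp add: field_simps)
    then show "r n (N n \<omega>) \<le> T \<omega> + d n" by (simp add: r_def)
  qed
  have mom: "S n \<in> borel_measurable M \<and> integrable M (\<lambda>\<omega>. (S n \<omega>)\<^sup>2) \<and>
    expectation (\<lambda>\<omega>. (S n \<omega>)\<^sup>2) = (\<Sum>k<Suc n. expectation (\<lambda>\<omega>. of_bool (r n k < T \<omega>)) * d n)" for n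
  proof -
    have "r n (Suc k) - r n k = d n" for k by (simp add: r_def algebra_simps)
    then show ?thesis
      using stopped_sum_second_moment[of "r n" T "Suc n"] T t d[of n]
        borel_measurable_F[of "S n" "r n (Suc n)"]
      unfolding S_def[abs_def] by (simp add: r_def del: sum.lessThan_Suc)
  qed
  \<comment> \<open>The isometry evaluates to the mean of \<open>N * d\<close>, the elapsed time
    rounded up to the grid, which exceeds \<open>T - t\<close> by at most one mesh width.\<close>
  have bound: "(\<integral>\<^sup>+\<omega>. ennreal ((S n \<omega>)\<^sup>2) \<partial>M) \<le> ennreal (expectation (\<lambda>\<omega>. T \<omega> - t) + d n)" for n
  proof -
    have "integrable M (\<lambda>\<omega>. of_bool (r n k < T \<omega>) :: real)" for k
      by (rule integrable_const_bound[of _ 1]) auto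
    then have "expectation (\<lambda>\<omega>. (S n \<omega>)\<^sup>2) = expectation (\<lambda>\<omega>. \<Sum>k<Suc n. of_bool (r n k < T \<omega>) * d n)"
      using mom[of n] by (subst Bochner_Integration.integral_sum) (auto simp del: sum.lessThan_Suc)
    also have "\<dots> \<le> expectation (\<lambda>\<omega>. T \<omega> - t + d n)"
    proof (rule integral_mono_AE)
      show "integrable M (\<lambda>\<omega>. \<Sum>k<Suc n. of_bool (r n k < T \<omega>) * d n)"
        by (intro Bochner_Integration.integrable_sum integrable_const_bound[of _ "d n"])
           (use d[of n] in auto)
      show "AE \<omega> in M. (\<Sum>k<Suc n. of_bool (r n k < T \<omega>) * d n) \<le> T \<omega> - t + d n"
      proof (rule AE_I2)
        fix \<omega> assume \<omega>: "\<omega> \<in> space M"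
        have "(\<Sum>k<Suc n. of_bool (r n k < T \<omega>) * d n) = (\<Sum>k<Suc n. if r n k < T \<omega> then d n else 0)"
          by (intro sum.cong) auto
        also have "\<dots> = real (N n \<omega>) * d n" unfolding trunc[OF \<omega>] by simp
        finally show "(\<Sum>k<Suc n. of_bool (r n k < T \<omega>) * d n) \<le> T \<omega> - t + d n"
          using rN(2)[OF \<omega>, of n] by (simp add: r_def)
      qed
    qed (use iT in auto)
    also have "\<dots> = expectation (\<lambda>\<omega>. T \<omega> - t) + d n" using iT by (simp add: prob_space)
    finally show ?thesis using mom[of n]
      by (subst nn_integral_eq_integral) (auto intro: ennreal_leI)
  qed
  have d0: "d \<longlonglongrightarrow> 0"
    unfolding d_def using LIMSEQ_Suc[OF lim_const_over_n[of "1 - t"]] by simp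
  have conv: "(\<lambda>n. ennreal ((S n \<omega>)\<^sup>2)) \<longlonglongrightarrow> ennreal ((B (T \<omega>) \<omega> - B t \<omega>)\<^sup>2)" if \<omega>: "\<omega> \<in> space M" for \<omega>
  proof -
    have "(\<lambda>n. r n (N n \<omega>)) \<longlonglongrightarrow> T \<omega>"
    proof (rule tendsto_sandwich)
      show "(\<lambda>n. T \<omega>) \<longlonglongrightarrow> T \<omega>" by (rule tendsto_const)
    next
      show "(\<lambda>n. T \<omega> + d n) \<longlonglongrightarrow> T \<omega>" using tendsto_add[OF tendsto_const d0, of "T \<omega>"] by simp
    qed (use rN[OF \<omega>] in \<open>auto intro!: always_eventually\<close>)
    then have "(\<lambda>n. B (r n (N n \<omega>)) \<omega>) \<longlonglongrightarrow> B (T \<omega>) \<omega>"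
      by (rule continuous_on_tendsto_compose[OF B_continuous[OF \<omega> subset_refl]])
         (use T_in[OF \<omega>] rN(1)[OF \<omega>] t in \<open>auto intro!: always_eventually intro: order_trans\<close>)
    then show ?thesis unfolding S_eq[OF \<omega>] by (intro tendsto_intros)
  qed
  have "(\<integral>\<^sup>+\<omega>. ennreal ((B (T \<omega>) \<omega> - B t \<omega>)\<^sup>2) \<partial>M) = (\<integral>\<^sup>+\<omega>. liminf (\<lambda>n. ennreal ((S n \<omega>)\<^sup>2)) \<partial>M)"
    by (intro nn_integral_cong lim_imp_Liminf[symmetric] conv) auto
  also have "\<dots> \<le> liminf (\<lambda>n. \<integral>\<^sup>+\<omega>. ennreal ((S n \<omega>)\<^sup>2) \<partial>M)"
    by (rule nn_integral_liminf) (use mom in auto)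
  also have "\<dots> \<le> liminf (\<lambda>n. ennreal (expectation (\<lambda>\<omega>. T \<omega> - t) + d n))"
    by (intro Liminf_mono always_eventually allI bound)
  also have "\<dots> = ennreal (expectation (\<lambda>\<omega>. T \<omega> - t) + 0)"
    by (intro lim_imp_Liminf tendsto_intros d0) auto
  also have "\<dots> = (\<integral>\<^sup>+\<omega>. ennreal (T \<omega> - t) \<partial>M)"
    using iT T_in by (subst nn_integral_eq_integral) (auto intro!: AE_I2)
  finally show ?thesis .
qed

section \<open>Second moments integrated over time\<close>

lemma B_jointly_measurable:
  assumes "0 \<le> t" "t \<le> s" and f: "f \<in> borel_measurable (M \<Otimes>\<^sub>M lborel)"
    and f_in: "\<And>p. p \<in> space M \<times> UNIV \<Longrightarrow> f p \<in> {t..s}"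
  shows "(\<lambda>(\<omega>, u). B (f (\<omega>, u)) \<omega>) \<in> borel_measurable (M \<Otimes>\<^sub>M lborel)"
proof -
  have "(\<lambda>p. (\<lambda>v p. B v (fst p)) (f p) p) \<in> borel_measurable (M \<Otimes>\<^sub>M lborel)"
    by (rule borel_measurable_at_random_time[of t s])
       (use assms in \<open>auto intro!: measurable_compose[OF measurable_fst B_measurable] B_continuous
          simp: space_pair_measure\<close>)
  then show ?thesis by (simp add: case_prod_beta')
qed

text \<open>Up to \<open>T\<close> the path agrees with the path stopped at \<open>T\<close>; for
  the latter, integrating up to time 1 can only increase the value. By Tonelli the stopped moment
  inequality applies at each \<open>u\<close> to the stopping time \<open>min u T\<close> and gives
  at most \<open>E[T - t]\<close>, over an interval of length \<open>1 - t \<le> 1\<close>.\<close>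

lemma stopped_integral_second_moment:
  assumes t: "0 \<le> t" "t < 1" and T: "stopping_time F T"
    and T_in: "\<And>\<omega>. \<omega> \<in> space M \<Longrightarrow> T \<omega> \<in> {t..1}"
  shows "(\<lambda>\<omega>. ennreal (integral {t..T \<omega>} (\<lambda>u. (B u \<omega> - B t \<omega>)\<^sup>2))) \<in> borel_measurable M" (is ?meas)
    and "(\<integral>\<^sup>+\<omega>. ennreal (integral {t..T \<omega>} (\<lambda>u. (B u \<omega> - B t \<omega>)\<^sup>2)) \<partial>M) \<le> (\<integral>\<^sup>+\<omega>. ennreal (T \<omega> - t) \<partial>M)" (is ?le)
proof -
  interpret P: pair_sigma_finite M lborel ..
  have [measurable]: "T \<in> borel_measurable M" by (rule stopping_time_measurable[OF T])
  have [measurable]: "B t \<in> borel_measurable M" using t by (intro B_measurable) auto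
  \<comment> \<open>The clamp freezes the path at \<open>T\<close> and keeps the evaluation time in
    \<open>{t..1}\<close> for every real second coordinate.\<close>
  define f where "f p = max t (min (snd p) (T (fst p)))" for p :: "'a \<times> real"
  have f: "f \<in> borel_measurable (M \<Otimes>\<^sub>M lborel)" unfolding f_def by measurable
  have fin: "f p \<in> {t..1}" if "p \<in> space M \<times> UNIV" for p
    using T_in[of "fst p"] that t by (auto simp: f_def)
  have [measurable]: "(\<lambda>(\<omega>, u). B (f (\<omega>, u)) \<omega>) \<in> borel_measurable (M \<Otimes>\<^sub>M lborel)"
    using t by (intro B_jointly_measurable[of t 1] f fin) auto
  define g where "g p = ennreal (of_bool (t \<le> snd p \<and> snd p \<le> T (fst p)) * (B (f p) (fst p) - B t (fst p))\<^sup>2)" for p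
  define h where "h p = ennreal (indicator {t..1} (snd p) * (B (f p) (fst p) - B t (fst p))\<^sup>2)" for p
  have Bf: "(\<lambda>p. B (f p) (fst p)) \<in> borel_measurable (M \<Otimes>\<^sub>M lborel)"
    using \<open>(\<lambda>(\<omega>, u). B (f (\<omega>, u)) \<omega>) \<in> _\<close> by (simp add: case_prod_beta')
  note [measurable] = Bf
  have g: "g \<in> borel_measurable (M \<Otimes>\<^sub>M lborel)" unfolding g_def by measurable
  have h: "h \<in> borel_measurable (M \<Otimes>\<^sub>M lborel)" unfolding h_def by measurable
  have eq: "ennreal (integral {t..T \<omega>} (\<lambda>u. (B u \<omega> - B t \<omega>)\<^sup>2)) = (\<integral>\<^sup>+u. g (\<omega>, u) \<partial>lborel)"
    if \<omega>: "\<omega> \<in> space M" for \<omega>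
  proof -
    have "ennreal (integral {t..T \<omega>} (\<lambda>u. (B u \<omega> - B t \<omega>)\<^sup>2)) =
       (\<integral>\<^sup>+u. ennreal (indicator {t..T \<omega>} u * (B u \<omega> - B t \<omega>)\<^sup>2) \<partial>lborel)"
      using t by (intro ennreal_integral_Icc continuous_intros B_continuous[OF \<omega>]) auto
    also have "\<dots> = (\<integral>\<^sup>+u. g (\<omega>, u) \<partial>lborel)"
      by (intro nn_integral_cong) (auto simp: g_def f_def indicator_def max_def min_def)
    finally show ?thesis .
  qed
  show ?meas
    by (subst measurable_cong[OF eq]) (auto intro!: lborel.borel_measurable_nn_integral_fst g)
  have "(\<integral>\<^sup>+\<omega>. ennreal (integral {t..T \<omega>} (\<lambda>u. (B u \<omega> - B t \<omega>)\<^sup>2)) \<partial>M)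
      = (\<integral>\<^sup>+\<omega>. (\<integral>\<^sup>+u. g (\<omega>, u) \<partial>lborel) \<partial>M)"
    by (intro nn_integral_cong eq)
  also have "\<dots> \<le> (\<integral>\<^sup>+\<omega>. (\<integral>\<^sup>+u. h (\<omega>, u) \<partial>lborel) \<partial>M)"
  proof (intro nn_integral_mono)
    fix \<omega> u assume "\<omega> \<in> space M"
    then show "g (\<omega>, u) \<le> h (\<omega>, u)"
      using T_in[of \<omega>] by (auto simp: g_def h_def)
  qed
  also have "\<dots> = (\<integral>\<^sup>+u. (\<integral>\<^sup>+\<omega>. h (\<omega>, u) \<partial>M) \<partial>lborel)"
    by (rule P.Fubini[OF h, symmetric])
  also have "\<dots> \<le> (\<integral>\<^sup>+u. indicator {t..1} u * (\<integral>\<^sup>+\<omega>. ennreal (T \<omega> - t) \<partial>M) \<partial>lborel)"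
  proof (rule nn_integral_mono)
    fix u :: real
    show "(\<integral>\<^sup>+\<omega>. h (\<omega>, u) \<partial>M) \<le> indicator {t..1} u * (\<integral>\<^sup>+\<omega>. ennreal (T \<omega> - t) \<partial>M)"
    proof (cases "u \<in> {t..1}")
      case True
      have "(\<integral>\<^sup>+\<omega>. h (\<omega>, u) \<partial>M) = (\<integral>\<^sup>+\<omega>. ennreal ((B (min u (T \<omega>)) \<omega> - B t \<omega>)\<^sup>2) \<partial>M)"
      proof (rule nn_integral_cong)
        fix \<omega> assume "\<omega> \<in> space M"
        then have "f (\<omega>, u) = min u (T \<omega>)" using T_in[of \<omega>] True by (auto simp: f_def)
        then show "h (\<omega>, u) = ennreal ((B (min u (T \<omega>)) \<omega> - B t \<omega>)\<^sup>2)"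
          using True by (simp add: h_def)
      qed
      also have "\<dots> \<le> (\<integral>\<^sup>+\<omega>. ennreal (min u (T \<omega>) - t) \<partial>M)"
      proof (rule stopped_second_moment_le[OF t])
        show "stopping_time F (\<lambda>\<omega>. min u (T \<omega>))"
          by (rule stopping_time_min[OF stopping_time_const T])
      qed (use True T_in in auto)
      also have "\<dots> \<le> (\<integral>\<^sup>+\<omega>. ennreal (T \<omega> - t) \<partial>M)"
        by (intro nn_integral_mono ennreal_leI) auto
      finally show ?thesis using True by simp
    qed (simp add: h_def)
  qed
  also have "\<dots> = ennreal (1 - t) * (\<integral>\<^sup>+\<omega>. ennreal (T \<omega> - t) \<partial>M)"
    using t by (simp add: nn_integral_multc)
  also have "\<dots> \<le> 1 * (\<integral>\<^sup>+\<omega>. ennreal (T \<omega> - t) \<partial>M)"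
    using t by (intro mult_right_mono) (auto simp: ennreal_le_1)
  finally show ?le by simp
qed

text \<open>The mean of \<open>(B u - B 1)^2\<close> is \<open>1 - u\<close> and cancels the weight,
  so by Tonelli the expectation is at most the length of \<open>{t..1}\<close>.\<close>

lemma pinned_integral_moment:
  assumes t: "0 \<le> t" "t < 1"
  defines "J \<equiv> \<lambda>\<omega>. \<integral>\<^sup>+u. ennreal (indicator {t..<1} u * ((B u \<omega> - B 1 \<omega>)\<^sup>2 / (1 - u))) \<partial>lborel"
  shows "J \<in> borel_measurable M" and "(\<integral>\<^sup>+\<omega>. J \<omega> \<partial>M) \<le> 1"
proof -
  interpret P: pair_sigma_finite M lborel ..
  have [measurable]: "B 1 \<in> borel_measurable M" by (simp add: B_measurable)
  define f :: "'a \<times> real \<Rightarrow> real" where "f p = max t (min (snd p) 1)" for p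
  have f: "f \<in> borel_measurable (M \<Otimes>\<^sub>M lborel)" unfolding f_def by measurable
  have fin: "f p \<in> {t..1}" for p using t by (auto simp: f_def)
  have [measurable]: "(\<lambda>p. B (f p) (fst p)) \<in> borel_measurable (M \<Otimes>\<^sub>M lborel)"
    using B_jointly_measurable[of t 1 f] f fin t by (simp add: case_prod_beta')
  define g where "g p = ennreal (indicator {t..<1} (snd p) * ((B (f p) (fst p) - B 1 (fst p))\<^sup>2 / (1 - snd p)))" for p
  have g: "g \<in> borel_measurable (M \<Otimes>\<^sub>M lborel)" unfolding g_def by measurable
  have Jg: "J \<omega> = (\<integral>\<^sup>+u. g (\<omega>, u) \<partial>lborel)" for \<omega>
    unfolding J_def by (intro nn_integral_cong) (auto simp: g_def f_def indicator_def)
  show "J \<in> borel_measurable M"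
    unfolding Jg[abs_def] by (rule lborel.borel_measurable_nn_integral_fst[OF g])
  have "(\<integral>\<^sup>+\<omega>. J \<omega> \<partial>M) = (\<integral>\<^sup>+u. (\<integral>\<^sup>+\<omega>. g (\<omega>, u) \<partial>M) \<partial>lborel)"
    unfolding Jg by (rule P.Fubini[OF g, symmetric])
  also have "\<dots> \<le> (\<integral>\<^sup>+u. indicator {t..1} u \<partial>lborel)"
  proof (rule nn_integral_mono)
    fix u :: real
    show "(\<integral>\<^sup>+\<omega>. g (\<omega>, u) \<partial>M) \<le> indicator {t..1} u"
    proof (cases "u \<in> {t..<1}")
      case True
      then have [measurable]: "B u \<in> borel_measurable M" using t by (intro B_measurable) auto
      have "(\<integral>\<^sup>+\<omega>. g (\<omega>, u) \<partial>M) = (\<integral>\<^sup>+\<omega>. ennreal (1 / (1 - u)) * ennreal ((B 1 \<omega> - B u \<omega>)\<^sup>2) \<partial>M)"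
        using True by (intro nn_integral_cong)
          (auto simp: g_def f_def ennreal_mult[symmetric] power2_commute[of "B u _"])
      also have "\<dots> = ennreal (1 / (1 - u)) * ennreal (1 - u)"
        using True t nn_integral_B_increment_square[of u 1] by (subst nn_integral_cmult) auto
      also have "\<dots> = 1" using True by (simp add: ennreal_mult[symmetric])
      finally show ?thesis using True by simp
    qed (simp add: g_def)
  qed
  also have "\<dots> \<le> 1" using t by (simp add: ennreal_le_1)
  finally show "(\<integral>\<^sup>+\<omega>. J \<omega> \<partial>M) \<le> 1" .
qed

section \<open>Measurability and moments of solutions at stopping times\<close>

lemma bridge_solution_measurable:
  assumes t: "0 \<le> t" "t < 1" and s: "t \<le> s" "s \<le> 1"
  shows "(\<lambda>\<omega>. bridge_solution \<alpha> z \<gamma> t x (\<lambda>u. B u \<omega>) s) \<in> borel_measurable M"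
proof (cases "s < 1")
  case True
  have [measurable]: "B t \<in> borel_measurable M" "B s \<in> borel_measurable M"
    using t s by (auto intro!: B_measurable)
  define f :: "'a \<times> real \<Rightarrow> real" where "f p = max t (min (snd p) s)" for p
  have f: "f \<in> borel_measurable (M \<Otimes>\<^sub>M lborel)" unfolding f_def by measurable
  have fin: "f p \<in> {t..s}" for p using s by (auto simp: f_def)
  have [measurable]: "(\<lambda>p. B (f p) (fst p)) \<in> borel_measurable (M \<Otimes>\<^sub>M lborel)"
    using B_jointly_measurable[of t s f] f fin t s by (simp add: case_prod_beta')
  have [measurable]: "bridge_scale \<alpha> \<in> borel_measurable borel"
    by (intro borel_measurable_continuous_onI continuous_intros)
  have [measurable]: "(\<lambda>u. cosh (\<alpha> * (1 - u))) \<in> borel_measurable borel"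
    by (intro borel_measurable_continuous_onI continuous_intros)
  define k where "k u b = (z - \<gamma> * cosh (\<alpha> * (1 - u)) * b) / (bridge_scale \<alpha> u)\<^sup>2" for u b
  define g where "g p = indicator {t..s} (snd p) *\<^sub>R k (snd p) (B (f p) (fst p) - B t (fst p))" for p
  have g: "g \<in> borel_measurable (M \<Otimes>\<^sub>M lborel)" unfolding g_def k_def by measurable
  have eq: "integral {t..s} (\<lambda>u. k u (B u \<omega> - B t \<omega>)) = (\<integral>u. g (\<omega>, u) \<partial>lborel)" if \<omega>: "\<omega> \<in> space M" for \<omega>
  proof -
    have "continuous_on {t..s} (\<lambda>u. k u (B u \<omega> - B t \<omega>))"
      unfolding k_def using t True bridge_scale_pos[of _ \<alpha>]
      by (intro continuous_intros B_continuous[OF \<omega>]) (auto simp: less_imp_neq[symmetric])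
    then have "integral {t..s} (\<lambda>u. k u (B u \<omega> - B t \<omega>)) = (LINT u:{t..s}|lborel. k u (B u \<omega> - B t \<omega>))"
      by (intro set_borel_integral_eq_integral(2)[symmetric] borel_integrable_atLeastAtMost')
    also have "\<dots> = (\<integral>u. g (\<omega>, u) \<partial>lborel)"
      unfolding set_lebesgue_integral_def
      by (intro Bochner_Integration.integral_cong) (auto simp: g_def f_def indicator_def)
    finally show ?thesis .
  qed
  have "(\<lambda>\<omega>. \<integral>u. g (\<omega>, u) \<partial>lborel) \<in> borel_measurable M"
    by (rule lborel.borel_measurable_lebesgue_integral) (use g in \<open>simp add: case_prod_beta'\<close>)
  then have [measurable]: "(\<lambda>\<omega>. integral {t..s} (\<lambda>u. k u (B u \<omega> - B t \<omega>))) \<in> borel_measurable M"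
    by (subst measurable_cong[OF eq])
  show ?thesis unfolding bridge_solution_def k_def[symmetric] using True by simp
qed (simp add: bridge_solution_def)

lemma bridge_solution_path:
  assumes "0 \<le> t" "t < 1" "\<omega> \<in> space M"
  shows "bridge_path (bridge_drift \<alpha> z) \<gamma> z t x (\<lambda>s. B s \<omega>) (bridge_solution \<alpha> z \<gamma> t x (\<lambda>u. B u \<omega>))"
  using assms by (intro bridge_path_bridge_solution B_continuous) auto

text \<open>\<open>Z\<close> is any family of solution paths, without a measurability assumption.
  Pathwise uniqueness identifies it at fixed times with the explicit solution, and path continuity
  takes care of the random time.\<close>

lemma bridge_at_stopping_time_measurable:
  assumes t: "0 \<le> t" "t < 1"
    and Z: "\<And>\<omega>. \<omega> \<in> space M \<Longrightarrow> bridge_path (bridge_drift \<alpha> z) \<gamma> z t x (\<lambda>s. B s \<omega>) (\<lambda>s. Z s \<omega>)"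
    and T: "stopping_time F T" and T_in: "\<And>\<omega>. \<omega> \<in> space M \<Longrightarrow> T \<omega> \<in> {t..1}"
  shows "(\<lambda>\<omega>. Z (T \<omega>) \<omega>) \<in> borel_measurable M"
proof (rule borel_measurable_at_random_time[of t 1 Z M T])
  fix s assume s: "s \<in> {t..1}"
  have "Z s \<omega> = bridge_solution \<alpha> z \<gamma> t x (\<lambda>u. B u \<omega>) s" if "\<omega> \<in> space M" for \<omega>
    using s by (intro bridge_path_unique[OF Z[OF that] bridge_solution_path[OF t that]]) auto
  then have "Z s \<in> borel_measurable M \<longleftrightarrow>
      (\<lambda>\<omega>. bridge_solution \<alpha> z \<gamma> t x (\<lambda>u. B u \<omega>) s) \<in> borel_measurable M"
    by (rule measurable_cong)
  then show "Z s \<in> borel_measurable M"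
    using bridge_solution_measurable[OF t, of s] s by simp
next
  fix \<omega> assume "\<omega> \<in> space M"
  then show "continuous_on {t..1} (\<lambda>s. Z s \<omega>)" by (rule bridge_path_continuous[OF Z])
qed (use t T_in stopping_time_measurable[OF T] in auto)

text \<open>The constant, the stopped squared increment, the squared increment up to time 1 and the
  pinned integral have expectation at most 1 each, hence the factor 4. The bound does not depend on
  \<open>T\<close>, which keeps the supremum in the value function finite.\<close>

lemma brownian_bridge_stopped_abs_moment:
  assumes t: "0 \<le> t" "t < 1"
    and Z: "\<And>\<omega>. \<omega> \<in> space M \<Longrightarrow> bridge_path (bridge_drift 0 z) \<gamma> z t x (\<lambda>s. B s \<omega>) (\<lambda>s. Z s \<omega>)"
    and T: "stopping_time F T" and T_in: "\<And>\<omega>. \<omega> \<in> space M \<Longrightarrow> T \<omega> \<in> {t..1}"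
  shows "(\<integral>\<^sup>+\<omega>. ennreal \<bar>Z (T \<omega>) \<omega>\<bar> \<partial>M) \<le> ennreal (4 * (\<bar>z\<bar> + 2 + 2 * (x - z)\<^sup>2 + 4 * \<gamma>\<^sup>2))"
proof -
  define C where "C = \<bar>z\<bar> + 2 + 2 * (x - z)\<^sup>2 + 4 * \<gamma>\<^sup>2"
  define J where "J \<omega> = (\<integral>\<^sup>+u. ennreal (indicator {t..<1} u * ((B u \<omega> - B 1 \<omega>)\<^sup>2 / (1 - u))) \<partial>lborel)" for \<omega>
  have C: "0 \<le> C" unfolding C_def by (intro add_nonneg_nonneg) auto
  have [measurable]: "T \<in> borel_measurable M" by (rule stopping_time_measurable[OF T])
  have [measurable]: "B t \<in> borel_measurable M" "B 1 \<in> borel_measurable M"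
    using t by (auto intro!: B_measurable)
  have [measurable]: "J \<in> borel_measurable M" and J1: "(\<integral>\<^sup>+\<omega>. J \<omega> \<partial>M) \<le> 1"
    unfolding J_def using pinned_integral_moment[OF t] by auto
  have [measurable]: "(\<lambda>\<omega>. B (T \<omega>) \<omega>) \<in> borel_measurable M"
    by (rule borel_measurable_at_random_time[of t 1])
       (use t T_in in \<open>auto intro!: B_measurable B_continuous\<close>)
  have T1: "(\<integral>\<^sup>+\<omega>. ennreal (T \<omega> - t) \<partial>M) \<le> 1"
  proof -
    have "(\<integral>\<^sup>+\<omega>. ennreal (T \<omega> - t) \<partial>M) \<le> (\<integral>\<^sup>+\<omega>. 1 \<partial>M)"
    proof (rule nn_integral_mono)
      fix \<omega> assume "\<omega> \<in> space M"
      then show "ennreal (T \<omega> - t) \<le> 1" using T_in[of \<omega>] t by (auto simp: ennreal_le_1)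
    qed
    then show ?thesis by (simp add: emeasure_space_1)
  qed
  have "(\<integral>\<^sup>+\<omega>. ennreal \<bar>Z (T \<omega>) \<omega>\<bar> \<partial>M) \<le>
     (\<integral>\<^sup>+\<omega>. ennreal C * (1 + (ennreal ((B (T \<omega>) \<omega> - B t \<omega>)\<^sup>2) + (ennreal ((B 1 \<omega> - B t \<omega>)\<^sup>2) + J \<omega>))) \<partial>M)"
  proof (rule nn_integral_mono)
    fix \<omega> assume \<omega>: "\<omega> \<in> space M"
    show "ennreal \<bar>Z (T \<omega>) \<omega>\<bar> \<le>
      ennreal C * (1 + (ennreal ((B (T \<omega>) \<omega> - B t \<omega>)\<^sup>2) + (ennreal ((B 1 \<omega> - B t \<omega>)\<^sup>2) + J \<omega>)))"
      unfolding C_def J_def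
      by (rule brownian_bridge_path_abs_bound[OF Z[OF \<omega>]])
         (use t T_in[OF \<omega>] in \<open>auto intro!: B_continuous \<omega>\<close>)
  qed
  also have "\<dots> = ennreal C * (1 + ((\<integral>\<^sup>+\<omega>. ennreal ((B (T \<omega>) \<omega> - B t \<omega>)\<^sup>2) \<partial>M) +
      ((\<integral>\<^sup>+\<omega>. ennreal ((B 1 \<omega> - B t \<omega>)\<^sup>2) \<partial>M) + (\<integral>\<^sup>+\<omega>. J \<omega> \<partial>M))))"
    by (simp add: nn_integral_cmult nn_integral_add emeasure_space_1)
  also have "\<dots> \<le> ennreal C * (1 + (1 + (1 + 1)))"
  proof (intro mult_left_mono add_mono order_refl J1)
    show "(\<integral>\<^sup>+\<omega>. ennreal ((B (T \<omega>) \<omega> - B t \<omega>)\<^sup>2) \<partial>M) \<le> 1"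
      using stopped_second_moment_le[OF t T T_in] T1 by (rule order_trans)
    show "(\<integral>\<^sup>+\<omega>. ennreal ((B 1 \<omega> - B t \<omega>)\<^sup>2) \<partial>M) \<le> 1"
      using t by (subst nn_integral_B_increment_square) (auto simp: ennreal_le_1)
  qed auto
  also have "\<dots> = ennreal (4 * C)" using C by (simp add: ennreal_mult mult.commute)
  finally show ?thesis unfolding C_def .
qed

end

section \<open>Value functions\<close>

context brownian_motion
begin

definition bridge_solutions where
  "bridge_solutions \<alpha> z \<gamma> t x =
     {Z. \<forall>\<omega>\<in>space M. bridge_path (bridge_drift \<alpha> z) \<gamma> z t x (\<lambda>s. B s \<omega>) (\<lambda>s. Z s \<omega>)}"

definition stopping_times_from where
  "stopping_times_from t = {T. stopping_time F T \<and> (\<forall>\<omega>\<in>space M. T \<omega> \<in> {t..1})}"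

lemma bridge_solutionsI:
  assumes "0 \<le> t" "t < 1"
  shows "(\<lambda>s \<omega>. bridge_solution \<alpha> z \<gamma> t x (\<lambda>u. B u \<omega>) s) \<in> bridge_solutions \<alpha> z \<gamma> t x"
  using bridge_solution_path[OF assms] by (auto simp: bridge_solutions_def)

lemma value_function_eq_Sup:
  "value_function M B (bridge_drift \<alpha> z) \<gamma> z t x =
     Sup {expectation (\<lambda>\<omega>. Z (T \<omega>) \<omega>) | Z T. Z \<in> bridge_solutions \<alpha> z \<gamma> t x \<and> T \<in> stopping_times_from t}"
proof -
  have "(\<exists>Z \<tau>. v = expectation (\<lambda>\<omega>. Z (t + \<tau> \<omega>) \<omega>) \<and>
         (\<forall>\<omega>\<in>space M. bridge_path (bridge_drift \<alpha> z) \<gamma> z t x (\<lambda>s. B s \<omega>) (\<lambda>s. Z s \<omega>)) \<and>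
         (\<forall>\<omega>\<in>space M. 0 \<le> \<tau> \<omega> \<and> \<tau> \<omega> \<le> 1 - t) \<and> stopping_time F (\<lambda>\<omega>. t + \<tau> \<omega>)) \<longleftrightarrow>
     (\<exists>Z T. v = expectation (\<lambda>\<omega>. Z (T \<omega>) \<omega>) \<and>
         Z \<in> bridge_solutions \<alpha> z \<gamma> t x \<and> T \<in> stopping_times_from t)" (is "?L \<longleftrightarrow> ?R") for v
  proof
    assume ?L
    then obtain Z \<tau> where *: "v = expectation (\<lambda>\<omega>. Z (t + \<tau> \<omega>) \<omega>)"
      "\<forall>\<omega>\<in>space M. bridge_path (bridge_drift \<alpha> z) \<gamma> z t x (\<lambda>s. B s \<omega>) (\<lambda>s. Z s \<omega>)"
      "\<forall>\<omega>\<in>space M. 0 \<le> \<tau> \<omega> \<and> \<tau> \<omega> \<le> 1 - t" "stopping_time F (\<lambda>\<omega>. t + \<tau> \<omega>)" by blast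
    show ?R
      by (intro exI[of _ Z] exI[of _ "\<lambda>\<omega>. t + \<tau> \<omega>"])
         (use * in \<open>auto simp: bridge_solutions_def stopping_times_from_def; force\<close>)
  next
    assume ?R
    then obtain Z T where *: "v = expectation (\<lambda>\<omega>. Z (T \<omega>) \<omega>)"
      "Z \<in> bridge_solutions \<alpha> z \<gamma> t x" "T \<in> stopping_times_from t" by blast
    show ?L
      by (intro exI[of _ Z] exI[of _ "\<lambda>\<omega>. T \<omega> - t"])
         (use * in \<open>auto simp: bridge_solutions_def stopping_times_from_def\<close>)
  qed
  then show ?thesis unfolding value_function_def by presburger
qed

lemma stopping_times_from_integrable:
  assumes "0 \<le> t" "T \<in> stopping_times_from t"
  shows "integrable M T" "expectation (\<lambda>\<omega>. T \<omega> - t) \<le> 1 - t" "0 \<le> expectation (\<lambda>\<omega>. T \<omega> - t)"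
proof -
  have T: "\<And>\<omega>. \<omega> \<in> space M \<Longrightarrow> T \<omega> \<in> {t..1}" "T \<in> borel_measurable M"
    using assms stopping_time_measurable by (auto simp: stopping_times_from_def)
  show i: "integrable M T"
  proof (rule integrable_const_bound[of _ 1])
    show "AE \<omega> in M. norm (T \<omega>) \<le> 1" using T(1) assms(1) by (intro AE_I2) force
  qed (rule T(2))
  have "expectation (\<lambda>\<omega>. T \<omega> - t) \<le> expectation (\<lambda>\<omega>. 1 - t)"
    using i T(1) by (intro integral_mono) auto
  then show "expectation (\<lambda>\<omega>. T \<omega> - t) \<le> 1 - t" by (simp add: prob_space)
  show "0 \<le> expectation (\<lambda>\<omega>. T \<omega> - t)"
    using T(1) by (intro Bochner_Integration.integral_nonneg) auto
qed

text \<open>Twice the constant of the pathwise integral bound: in expectation, \<open>T - t\<close>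
  and the integral of \<open>(B u - B t)^2\<close> up to \<open>T\<close> contribute at most
  \<open>E[T - t]\<close> each.\<close>

definition perturbation_constant :: "real \<Rightarrow> real \<Rightarrow> real \<Rightarrow> real" where
  "perturbation_constant z \<gamma> x = 2 * (\<bar>z\<bar> + \<bar>x\<bar> + 2 + 2 * (z - x)\<^sup>2 + 3 * \<gamma>\<^sup>2)"

lemma perturbation_constant_pos: "0 < perturbation_constant z \<gamma> x"
  unfolding perturbation_constant_def
  by (intro mult_pos_pos add_pos_nonneg add_nonneg_pos) auto

text \<open>The factor \<open>expectation (\<lambda>\<omega>. T \<omega> - t)\<close>, rather than a mere constant, is what makes the
  boundaries converge: starting above the limiting boundary costs the Brownian bridge an amount
  proportional to it.\<close>
lemma bridge_expectation_perturbation: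
  assumes t: "0 \<le> t" "t < 1" and \<alpha>: "\<bar>\<alpha>\<bar> \<le> 1"
    and Z: "Z \<in> bridge_solutions \<alpha> z \<gamma> t x" and Z0: "Z0 \<in> bridge_solutions 0 z \<gamma> t x"
    and T: "T \<in> stopping_times_from t"
  shows "integrable M (\<lambda>\<omega>. Z0 (T \<omega>) \<omega>)"
    and "\<bar>expectation (\<lambda>\<omega>. Z0 (T \<omega>) \<omega>)\<bar> \<le> 4 * (\<bar>z\<bar> + 2 + 2 * (x - z)\<^sup>2 + 4 * \<gamma>\<^sup>2)"
    and "\<bar>expectation (\<lambda>\<omega>. Z (T \<omega>) \<omega>) - expectation (\<lambda>\<omega>. Z0 (T \<omega>) \<omega>)\<bar>
      \<le> perturbation_constant z \<gamma> x * \<alpha>\<^sup>2 * expectation (\<lambda>\<omega>. T \<omega> - t)"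
proof -
  define C where "C = \<bar>z\<bar> + \<bar>x\<bar> + 2 + 2 * (z - x)\<^sup>2 + 3 * \<gamma>\<^sup>2"
  define K where "K = 4 * (\<bar>z\<bar> + 2 + 2 * (x - z)\<^sup>2 + 4 * \<gamma>\<^sup>2)"
  define e where "e = expectation (\<lambda>\<omega>. T \<omega> - t)"
  define I where "I \<omega> = integral {t..T \<omega>} (\<lambda>u. (B u \<omega> - B t \<omega>)\<^sup>2)" for \<omega>
  have C: "0 \<le> C" unfolding C_def by (intro add_nonneg_nonneg) auto
  have K: "0 \<le> K" unfolding K_def by (intro mult_nonneg_nonneg add_nonneg_nonneg) auto
  have st: "stopping_time F T" and T_in: "\<And>\<omega>. \<omega> \<in> space M \<Longrightarrow> T \<omega> \<in> {t..1}"
    using T by (auto simp: stopping_times_from_def)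
  have e0: "0 \<le> e" unfolding e_def by (rule stopping_times_from_integrable[OF t(1) T])
  note iT = stopping_times_from_integrable(1)[OF t(1) T]
  have [measurable]: "T \<in> borel_measurable M" by (rule stopping_time_measurable[OF st])
  have e: "(\<integral>\<^sup>+\<omega>. ennreal (T \<omega> - t) \<partial>M) = ennreal e"
    unfolding e_def using iT T_in by (intro nn_integral_eq_integral) (auto intro!: AE_I2)
  have Zp: "\<And>\<omega>. \<omega> \<in> space M \<Longrightarrow> bridge_path (bridge_drift \<alpha> z) \<gamma> z t x (\<lambda>s. B s \<omega>) (\<lambda>s. Z s \<omega>)"
    and Z0p: "\<And>\<omega>. \<omega> \<in> space M \<Longrightarrow> bridge_path (bridge_drift 0 z) \<gamma> z t x (\<lambda>s. B s \<omega>) (\<lambda>s. Z0 s \<omega>)"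
    using Z Z0 by (auto simp: bridge_solutions_def)
  note [measurable] = bridge_at_stopping_time_measurable[OF t Zp st T_in]
    bridge_at_stopping_time_measurable[OF t Z0p st T_in]
  have nn0: "(\<integral>\<^sup>+\<omega>. ennreal \<bar>Z0 (T \<omega>) \<omega>\<bar> \<partial>M) \<le> ennreal K"
    unfolding K_def by (rule brownian_bridge_stopped_abs_moment[OF t Z0p st T_in])
  show i0: "integrable M (\<lambda>\<omega>. Z0 (T \<omega>) \<omega>)"
    using nn0 by (intro integrableI_bounded) (auto intro: le_less_trans)
  have "ennreal (expectation (\<lambda>\<omega>. \<bar>Z0 (T \<omega>) \<omega>\<bar>)) \<le> ennreal K"
    using nn0 i0 by (subst (asm) nn_integral_eq_integral) auto
  then have "expectation (\<lambda>\<omega>. \<bar>Z0 (T \<omega>) \<omega>\<bar>) \<le> K" using K by simp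
  then show "\<bar>expectation (\<lambda>\<omega>. Z0 (T \<omega>) \<omega>)\<bar> \<le> 4 * (\<bar>z\<bar> + 2 + 2 * (x - z)\<^sup>2 + 4 * \<gamma>\<^sup>2)"
    unfolding K_def using integral_abs_bound[of M "\<lambda>\<omega>. Z0 (T \<omega>) \<omega>"] by linarith
  note I_moment = stopped_integral_second_moment[OF t st T_in, folded I_def]
  have "(\<integral>\<^sup>+\<omega>. ennreal \<bar>Z (T \<omega>) \<omega> - Z0 (T \<omega>) \<omega>\<bar> \<partial>M)
      \<le> (\<integral>\<^sup>+\<omega>. ennreal (\<alpha>\<^sup>2 * C) * (ennreal (T \<omega> - t) + ennreal (I \<omega>)) \<partial>M)"
  proof (rule nn_integral_mono)
    fix \<omega> assume \<omega>: "\<omega> \<in> space M"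
    have Tw: "t \<le> T \<omega>" "T \<omega> \<le> 1" using T_in[OF \<omega>] by auto
    have c: "continuous_on {t..1} (\<lambda>s. B s \<omega>)" using t by (intro B_continuous \<omega>) auto
    have I0: "0 \<le> I \<omega>" unfolding I_def
      by (rule Henstock_Kurzweil_Integration.integral_nonneg)
         (use Tw in \<open>auto intro!: integrable_continuous_interval continuous_intros continuous_on_subset[OF c]\<close>)
    have "\<bar>Z (T \<omega>) \<omega> - Z0 (T \<omega>) \<omega>\<bar> \<le> \<alpha>\<^sup>2 * integral {t..T \<omega>} (\<lambda>u. \<bar>z\<bar> + \<bar>Z0 u \<omega>\<bar>)"
      by (rule bridge_path_perturbation[OF Zp[OF \<omega>] Z0p[OF \<omega>] \<alpha> t(1) Tw])
    also have "\<dots> \<le> \<alpha>\<^sup>2 * (C * ((T \<omega> - t) + I \<omega>))"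
      unfolding C_def I_def
      by (intro mult_left_mono brownian_bridge_path_integral_bound[OF Z0p[OF \<omega>] c Tw t(2)]) auto
    finally have "ennreal \<bar>Z (T \<omega>) \<omega> - Z0 (T \<omega>) \<omega>\<bar> \<le> ennreal ((\<alpha>\<^sup>2 * C) * ((T \<omega> - t) + I \<omega>))"
      by (intro ennreal_leI) (simp add: mult.assoc)
    also have "\<dots> = ennreal (\<alpha>\<^sup>2 * C) * (ennreal (T \<omega> - t) + ennreal (I \<omega>))"
      using C Tw I0 by (subst ennreal_mult) auto
    finally show "ennreal \<bar>Z (T \<omega>) \<omega> - Z0 (T \<omega>) \<omega>\<bar> \<le> \<dots>" .
  qed
  also have "\<dots> = ennreal (\<alpha>\<^sup>2 * C) * ((\<integral>\<^sup>+\<omega>. ennreal (T \<omega> - t) \<partial>M) + (\<integral>\<^sup>+\<omega>. ennreal (I \<omega>) \<partial>M))"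
    using I_moment(1) by (subst nn_integral_cmult, measurable) (subst nn_integral_add, auto)
  also have "\<dots> \<le> ennreal (\<alpha>\<^sup>2 * C) * (ennreal e + ennreal e)"
    using I_moment(2) unfolding e by (intro mult_left_mono add_mono) auto
  also have "\<dots> = ennreal (2 * C * \<alpha>\<^sup>2 * e)"
    using C e0 by (simp add: ennreal_plus[symmetric] ennreal_mult[symmetric] algebra_simps del: ennreal_plus)
  finally have nn: "(\<integral>\<^sup>+\<omega>. ennreal \<bar>Z (T \<omega>) \<omega> - Z0 (T \<omega>) \<omega>\<bar> \<partial>M) \<le> ennreal (2 * C * \<alpha>\<^sup>2 * e)" .
  have id: "integrable M (\<lambda>\<omega>. Z (T \<omega>) \<omega> - Z0 (T \<omega>) \<omega>)"
    using nn by (intro integrableI_bounded) (auto intro: le_less_trans)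
  \<comment> \<open>The direct moment bound concerns the Brownian bridge; \<open>Z\<close> inherits
    integrability through the difference.\<close>
  have i: "integrable M (\<lambda>\<omega>. Z (T \<omega>) \<omega>)"
    using Bochner_Integration.integrable_add[OF id i0] by simp
  have "ennreal (expectation (\<lambda>\<omega>. \<bar>Z (T \<omega>) \<omega> - Z0 (T \<omega>) \<omega>\<bar>)) \<le> ennreal (2 * C * \<alpha>\<^sup>2 * e)"
    using nn id by (subst (asm) nn_integral_eq_integral) auto
  then have "expectation (\<lambda>\<omega>. \<bar>Z (T \<omega>) \<omega> - Z0 (T \<omega>) \<omega>\<bar>) \<le> 2 * C * \<alpha>\<^sup>2 * e"
    using C e0 by (subst (asm) ennreal_le_iff) auto
  moreover have "expectation (\<lambda>\<omega>. Z (T \<omega>) \<omega> - Z0 (T \<omega>) \<omega>) =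
      expectation (\<lambda>\<omega>. Z (T \<omega>) \<omega>) - expectation (\<lambda>\<omega>. Z0 (T \<omega>) \<omega>)"
    using i i0 by simp
  ultimately show "\<bar>expectation (\<lambda>\<omega>. Z (T \<omega>) \<omega>) - expectation (\<lambda>\<omega>. Z0 (T \<omega>) \<omega>)\<bar>
      \<le> perturbation_constant z \<gamma> x * \<alpha>\<^sup>2 * expectation (\<lambda>\<omega>. T \<omega> - t)"
    using integral_abs_bound[of M "\<lambda>\<omega>. Z (T \<omega>) \<omega> - Z0 (T \<omega>) \<omega>"]
    unfolding perturbation_constant_def C_def e_def by linarith
qed

section \<open>Order and stability of the value functions\<close>

lemma const_stopping_times_from: "t < 1 \<Longrightarrow> (\<lambda>_. t) \<in> stopping_times_from t"
  by (simp add: stopping_times_from_def stopping_time_const)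

lemma value_function_least:
  assumes "0 \<le> t" "t < 1"
    and "\<And>Z T. Z \<in> bridge_solutions \<alpha> z \<gamma> t x \<Longrightarrow> T \<in> stopping_times_from t \<Longrightarrow>
      expectation (\<lambda>\<omega>. Z (T \<omega>) \<omega>) \<le> c"
  shows "value_function M B (bridge_drift \<alpha> z) \<gamma> z t x \<le> c"
  unfolding value_function_eq_Sup
proof (rule cSup_least)
  show "{expectation (\<lambda>\<omega>. Z (T \<omega>) \<omega>) |Z T. Z \<in> bridge_solutions \<alpha> z \<gamma> t x \<and> T \<in> stopping_times_from t} \<noteq> {}"
    using bridge_solutionsI[OF assms(1,2)] const_stopping_times_from[OF assms(2)] by blast
qed (use assms(3) in blast)

text \<open>A real \<open>Sup\<close> is known to dominate its members once the set is bounded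
  above. The bound \<open>K\<close> adds the perturbation error to the moment bound of the Brownian
  bridge, which is where \<open>|\<alpha>| \<le> 1\<close> enters.\<close>

lemma value_function_upper:
  assumes t: "0 \<le> t" "t < 1" and \<alpha>: "\<bar>\<alpha>\<bar> \<le> 1"
    and Z: "Z \<in> bridge_solutions \<alpha> z \<gamma> t x" and T: "T \<in> stopping_times_from t"
  shows "expectation (\<lambda>\<omega>. Z (T \<omega>) \<omega>) \<le> value_function M B (bridge_drift \<alpha> z) \<gamma> z t x"
  unfolding value_function_eq_Sup
proof (rule cSup_upper)
  show "expectation (\<lambda>\<omega>. Z (T \<omega>) \<omega>) \<in>
    {expectation (\<lambda>\<omega>. Z (T \<omega>) \<omega>) |Z T. Z \<in> bridge_solutions \<alpha> z \<gamma> t x \<and> T \<in> stopping_times_from t}"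
    using Z T by blast
  define K where "K = 4 * (\<bar>z\<bar> + 2 + 2 * (x - z)\<^sup>2 + 4 * \<gamma>\<^sup>2) + perturbation_constant z \<gamma> x"
  have "expectation (\<lambda>\<omega>. Z (T \<omega>) \<omega>) \<le> K"
    if Z: "Z \<in> bridge_solutions \<alpha> z \<gamma> t x" and T: "T \<in> stopping_times_from t" for Z T
  proof -
    note p = bridge_expectation_perturbation[OF t \<alpha> Z bridge_solutionsI[OF t] T]
    have "perturbation_constant z \<gamma> x * \<alpha>\<^sup>2 * expectation (\<lambda>\<omega>. T \<omega> - t) \<le> perturbation_constant z \<gamma> x * 1 * 1"
      using stopping_times_from_integrable[OF t(1) T] t \<alpha> perturbation_constant_pos[of z \<gamma> x]
      by (intro mult_mono) (auto simp: abs_square_le_1)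
    with p(2,3) show ?thesis unfolding K_def by linarith
  qed
  then show "bdd_above {expectation (\<lambda>\<omega>. Z (T \<omega>) \<omega>) |Z T. Z \<in> bridge_solutions \<alpha> z \<gamma> t x \<and> T \<in> stopping_times_from t}"
    by (intro bdd_aboveI[of _ K]) blast
qed

lemma value_function_ge:
  assumes t: "0 \<le> t" "t < 1" and \<alpha>: "\<bar>\<alpha>\<bar> \<le> 1"
  shows "x \<le> value_function M B (bridge_drift \<alpha> z) \<gamma> z t x"
proof -
  have "bridge_solution \<alpha> z \<gamma> t x (\<lambda>u. B u \<omega>) t = x" for \<omega>
    using t bridge_scale_pos[of t \<alpha>] by (simp add: bridge_solution_def)
  then show ?thesis
    using value_function_upper[OF t \<alpha> bridge_solutionsI[OF t] const_stopping_times_from[OF t(2)], of z \<gamma> x]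
    by (simp add: prob_space)
qed

text \<open>\<open>E[T - t] \<le> 1\<close> makes the perturbation error uniform in
  \<open>T\<close>, so it passes to the suprema in both directions.\<close>

lemma value_function_perturbation:
  assumes t: "0 \<le> t" "t < 1" and \<alpha>: "\<bar>\<alpha>\<bar> \<le> 1"
  shows "\<bar>value_function M B (bridge_drift \<alpha> z) \<gamma> z t x - value_function M B (bridge_drift 0 z) \<gamma> z t x\<bar>
    \<le> perturbation_constant z \<gamma> x * \<alpha>\<^sup>2"
proof -
  let ?V = "value_function M B (bridge_drift \<alpha> z) \<gamma> z t x"
  let ?W = "value_function M B (bridge_drift 0 z) \<gamma> z t x"
  let ?C = "perturbation_constant z \<gamma> x"
  have d: "\<bar>expectation (\<lambda>\<omega>. Z (T \<omega>) \<omega>) - expectation (\<lambda>\<omega>. Z0 (T \<omega>) \<omega>)\<bar> \<le> ?C * \<alpha>\<^sup>2"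
    if "Z \<in> bridge_solutions \<alpha> z \<gamma> t x" "Z0 \<in> bridge_solutions 0 z \<gamma> t x" "T \<in> stopping_times_from t" for Z Z0 T
  proof -
    have "?C * \<alpha>\<^sup>2 * expectation (\<lambda>\<omega>. T \<omega> - t) \<le> ?C * \<alpha>\<^sup>2 * 1"
      using stopping_times_from_integrable[OF t(1) that(3)] t perturbation_constant_pos[of z \<gamma> x]
      by (intro mult_left_mono) auto
    with bridge_expectation_perturbation(3)[OF t \<alpha> that] show ?thesis by linarith
  qed
  have "?V \<le> ?W + ?C * \<alpha>\<^sup>2"
  proof (rule value_function_least[OF t])
    fix Z T assume *: "Z \<in> bridge_solutions \<alpha> z \<gamma> t x" "T \<in> stopping_times_from t"
    show "expectation (\<lambda>\<omega>. Z (T \<omega>) \<omega>) \<le> ?W + ?C * \<alpha>\<^sup>2"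
      using d[OF *(1) bridge_solutionsI[OF t] *(2)] value_function_upper[OF t _ bridge_solutionsI[OF t] *(2), of 0 z \<gamma> x]
      by simp
  qed
  moreover have "?W \<le> ?V + ?C * \<alpha>\<^sup>2"
  proof (rule value_function_least[OF t])
    fix Z T assume *: "Z \<in> bridge_solutions 0 z \<gamma> t x" "T \<in> stopping_times_from t"
    show "expectation (\<lambda>\<omega>. Z (T \<omega>) \<omega>) \<le> ?V + ?C * \<alpha>\<^sup>2"
      using d[OF bridge_solutionsI[OF t] *] value_function_upper[OF t \<alpha> bridge_solutionsI[OF t] *(2), of z \<gamma> x]
      by simp
  qed
  ultimately show ?thesis by linarith
qed

text \<open>Three processes are stopped at the same \<open>T\<close>: \<open>Z\<close>; the Brownian
  bridge \<open>Z0\<close> from \<open>x\<close>, close to it in mean; and its shift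
  \<open>Zy\<close> from \<open>y\<close>, whose mean is at most \<open>y\<close>. Error and shift
  loss are both multiples of \<open>E[T - t]\<close>, so \<open>small\<close> compares coefficients
  only and one threshold serves every \<open>T\<close>.\<close>

lemma value_function_eq_above_stopping_point:
  assumes t: "0 \<le> t" "t < 1" and \<alpha>: "\<bar>\<alpha>\<bar> \<le> 1" and yx: "y < x"
    and y: "value_function M B (bridge_drift 0 z) \<gamma> z t y = y"
    and small: "perturbation_constant z \<gamma> x * \<alpha>\<^sup>2 \<le> (x - y) / (1 - t)"
  shows "value_function M B (bridge_drift \<alpha> z) \<gamma> z t x = x"
proof (rule antisym[OF _ value_function_ge[OF t \<alpha>]], rule value_function_least[OF t])
  fix Z T assume Z: "Z \<in> bridge_solutions \<alpha> z \<gamma> t x" and T: "T \<in> stopping_times_from t"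
  define e where "e = expectation (\<lambda>\<omega>. T \<omega> - t)"
  note iT = stopping_times_from_integrable[OF t(1) T]
  define Z0 where "Z0 s \<omega> = bridge_solution 0 z \<gamma> t x (\<lambda>u. B u \<omega>) s" for s \<omega>
  have Z0: "Z0 \<in> bridge_solutions 0 z \<gamma> t x"
    unfolding Z0_def[abs_def] by (rule bridge_solutionsI[OF t])
  define Zy where "Zy s \<omega> = Z0 s \<omega> + (y - x) * (1 - s) / (1 - t)" for s \<omega>
  have Zy: "Zy \<in> bridge_solutions 0 z \<gamma> t y"
    using Z0 brownian_bridge_path_affine_start[OF _ t(2)] by (auto simp: bridge_solutions_def Zy_def)
  note p = bridge_expectation_perturbation[OF t \<alpha> Z Z0 T, folded e_def]
  \<comment> \<open>Rewriting in terms of the elapsed time \<open>T - t\<close> turns the mean of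
    the shift into an affine expression in \<open>e\<close>.\<close>
  have "(y - x) * (1 - T \<omega>) / (1 - t) = (y - x) - (y - x) / (1 - t) * (T \<omega> - t)" for \<omega>
    using t by (simp add: field_simps)
  then have "expectation (\<lambda>\<omega>. Zy (T \<omega>) \<omega>) =
      expectation (\<lambda>\<omega>. Z0 (T \<omega>) \<omega> + ((y - x) - (y - x) / (1 - t) * (T \<omega> - t)))"
    by (simp add: Zy_def)
  also have "\<dots> = expectation (\<lambda>\<omega>. Z0 (T \<omega>) \<omega>) + ((y - x) - (y - x) / (1 - t) * e)"
    unfolding e_def using p(1) iT(1) by (simp add: prob_space)
  finally have "expectation (\<lambda>\<omega>. Z0 (T \<omega>) \<omega>) + ((y - x) - (y - x) / (1 - t) * e) \<le> y"
    using value_function_upper[OF t _ Zy T] y by simp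
  then have "expectation (\<lambda>\<omega>. Z0 (T \<omega>) \<omega>) \<le> x - (x - y) / (1 - t) * e"
    by (simp add: diff_divide_distrib algebra_simps)
  moreover have "perturbation_constant z \<gamma> x * \<alpha>\<^sup>2 * e \<le> (x - y) / (1 - t) * e"
    using small iT(3) by (intro mult_right_mono) (auto simp: e_def)
  ultimately show "expectation (\<lambda>\<omega>. Z (T \<omega>) \<omega>) \<le> x" using p(3) by linarith
qed

end

section \<open>Passage to the limit\<close>

lemma tendsto_const_mult_square_at_0: "((\<lambda>\<alpha>::real. c * \<alpha>\<^sup>2) \<longlongrightarrow> 0) (at 0)"
  by (rule tendsto_eq_intros refl | simp)+

lemma eventually_abs_le_1_at_0: "eventually (\<lambda>\<alpha>::real. \<bar>\<alpha>\<bar> \<le> 1 \<and> \<alpha> \<noteq> 0) (at 0)"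
  unfolding eventually_at by (intro exI[of _ 1]) (auto simp: dist_real_def)

theorem mainTheorem4:
  fixes M :: "'a measure"
    and B :: "real \<Rightarrow> 'a \<Rightarrow> real"
    and z \<gamma> x\<^sub>0 :: real
    and X :: "real \<Rightarrow> real \<Rightarrow> 'a \<Rightarrow> real"
    and X' :: "real \<Rightarrow> 'a \<Rightarrow> real"
    and V :: "real \<Rightarrow> real \<Rightarrow> real \<Rightarrow> real"
    and V' :: "real \<Rightarrow> real \<Rightarrow> real"
    and \<beta> :: "real \<Rightarrow> real \<Rightarrow> real"
    and \<beta>' :: "real \<Rightarrow> real"
  defines "V \<equiv> \<lambda>\<alpha>. value_function M B (ou_bridge_drift \<alpha> z) \<gamma> z"
    and "V' \<equiv> value_function M B (brownian_bridge_drift z) \<gamma> z"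
  assumes "\<gamma> > 0"
    and "standard_brownian_motion M B"
    and "AE \<omega> in M. \<forall>\<alpha>. \<alpha> \<noteq> 0 \<longrightarrow>
           bridge_path (ou_bridge_drift \<alpha> z) \<gamma> z 0 x\<^sub>0 (\<lambda>s. B s \<omega>) (\<lambda>s. X \<alpha> s \<omega>)"
    and "AE \<omega> in M. bridge_path (brownian_bridge_drift z) \<gamma> z 0 x\<^sub>0 (\<lambda>s. B s \<omega>) (\<lambda>s. X' s \<omega>)"
    and "\<And>\<alpha>. \<alpha> \<noteq> 0 \<Longrightarrow> is_stopping_boundary (V \<alpha>) (\<beta> \<alpha>)"
    and "is_stopping_boundary V' \<beta>'"
  shows "(AE \<omega> in M. \<forall>t\<in>{0..<1}. ((\<lambda>\<alpha>. X \<alpha> t \<omega>) \<longlongrightarrow> X' t \<omega>) (at 0)) \<and>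
         (\<forall>t\<in>{0..<1}. \<forall>x. ((\<lambda>\<alpha>. V \<alpha> t x) \<longlongrightarrow> V' t x) (at 0)) \<and>
         (\<forall>t\<in>{0..<1}. ((\<lambda>\<alpha>. \<beta> \<alpha> t) \<longlongrightarrow> \<beta>' t) (at 0))"
proof (intro conjI)
  interpret prob_space M using assms(4) by (simp add: standard_brownian_motion_def)
  interpret brownian_motion M B by standard (rule assms(4))
  have V: "V \<alpha> = value_function M B (bridge_drift \<alpha> z) \<gamma> z" if "\<alpha> \<noteq> 0" for \<alpha>
    using that by (simp add: V_def ou_bridge_drift_eq)
  have V': "V' = value_function M B (bridge_drift 0 z) \<gamma> z"
    by (simp add: V'_def brownian_bridge_drift_eq)
  show "AE \<omega> in M. \<forall>t\<in>{0..<1}. ((\<lambda>\<alpha>. X \<alpha> t \<omega>) \<longlongrightarrow> X' t \<omega>) (at 0)"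
    using assms(5,6)
  proof eventually_elim
    case (elim \<omega>)
    show ?case
    proof
      fix t :: real assume t: "t \<in> {0..<1}"
      show "((\<lambda>\<alpha>. X \<alpha> t \<omega>) \<longlongrightarrow> X' t \<omega>) (at 0)"
      proof (rule Lim_transform2[OF tendsto_const], rule Lim_null_comparison)
        \<comment> \<open>Here \<open>\<omega>\<close> and \<open>t\<close> are fixed, so the
          integral is a constant; the exceptional null set is common to all parameters and
          times.\<close>
        show "eventually (\<lambda>\<alpha>. norm (X' t \<omega> - X \<alpha> t \<omega>) \<le> integral {0..t} (\<lambda>u. \<bar>z\<bar> + \<bar>X' u \<omega>\<bar>) * \<alpha>\<^sup>2) (at 0)"
          using eventually_abs_le_1_at_0
        proof eventually_elim
          case e: (elim \<alpha>)
          have "bridge_path (bridge_drift \<alpha> z) \<gamma> z 0 x\<^sub>0 (\<lambda>s. B s \<omega>) (\<lambda>s. X \<alpha> s \<omega>)"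
            "bridge_path (bridge_drift 0 z) \<gamma> z 0 x\<^sub>0 (\<lambda>s. B s \<omega>) (\<lambda>s. X' s \<omega>)"
            using elim e by (auto simp: ou_bridge_drift_eq brownian_bridge_drift_eq)
          from bridge_path_perturbation[OF this, of t] show ?case
            using t e by (simp add: abs_minus_commute mult.commute)
        qed
      qed (rule tendsto_const_mult_square_at_0)
    qed
  qed
  show V_lim: "\<forall>t\<in>{0..<1}. \<forall>x. ((\<lambda>\<alpha>. V \<alpha> t x) \<longlongrightarrow> V' t x) (at 0)"
  proof (intro ballI allI)
    fix t x :: real assume t: "t \<in> {0..<1}"
    show "((\<lambda>\<alpha>. V \<alpha> t x) \<longlongrightarrow> V' t x) (at 0)"
    proof (rule Lim_transform2[OF tendsto_const], rule Lim_null_comparison)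
      show "eventually (\<lambda>\<alpha>. norm (V' t x - V \<alpha> t x) \<le> perturbation_constant z \<gamma> x * \<alpha>\<^sup>2) (at 0)"
        using eventually_abs_le_1_at_0
      proof eventually_elim
        case (elim \<alpha>)
        then show ?case
          using value_function_perturbation[of t \<alpha> z \<gamma> x] t by (simp add: V V' abs_minus_commute)
      qed
    qed (rule tendsto_const_mult_square_at_0)
  qed
  have \<beta>: "V \<alpha> t x = x \<longleftrightarrow> \<beta> \<alpha> t \<le> x" if "\<alpha> \<noteq> 0" "t \<in> {0..<1}" for \<alpha> t x
    using assms(7)[OF that(1)] that(2) unfolding is_stopping_boundary_def set_eq_iff by auto
  have \<beta>': "V' t x = x \<longleftrightarrow> \<beta>' t \<le> x" if "t \<in> {0..<1}" for t x
    using assms(8) that unfolding is_stopping_boundary_def set_eq_iff by auto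
  show "\<forall>t\<in>{0..<1}. ((\<lambda>\<alpha>. \<beta> \<alpha> t) \<longlongrightarrow> \<beta>' t) (at 0)"
  proof
    fix t :: real assume t: "t \<in> {0..<1}"
    show "((\<lambda>\<alpha>. \<beta> \<alpha> t) \<longlongrightarrow> \<beta>' t) (at 0)"
    proof (rule order_tendstoI)
      \<comment> \<open>Below the limiting boundary continuing is strictly better; this strict
        inequality passes to nearby parameters by convergence of the values at
        \<open>a\<close>.\<close>
      fix a assume a: "a < \<beta>' t"
      then have "V' t a \<noteq> a" using \<beta>'[OF t] by simp
      moreover have "a \<le> V' t a" unfolding V' using t by (intro value_function_ge) auto
      ultimately have "a < V' t a" by simp
      moreover from V_lim t have "((\<lambda>\<alpha>. V \<alpha> t a) \<longlongrightarrow> V' t a) (at 0)" by blast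
      ultimately have "eventually (\<lambda>\<alpha>. a < V \<alpha> t a) (at 0)" by (simp add: order_tendstoD)
      then show "eventually (\<lambda>\<alpha>. a < \<beta> \<alpha> t) (at 0)"
        using eventually_abs_le_1_at_0
      proof eventually_elim
        case (elim \<alpha>)
        then show ?case using \<beta>[of \<alpha> t a] t by auto
      qed
    next
      fix a assume "\<beta>' t < a"
      \<comment> \<open>The intermediate point leaves room on both sides:
        \<open>x - \<beta>' t > 0\<close> is the margin that has to beat the perturbation, and
        \<open>\<beta> \<alpha> t \<le> x < a\<close> makes the conclusion strict.\<close>
      then obtain x where x: "\<beta>' t < x" "x < a" using dense by blast
      have "0 < (x - \<beta>' t) / (1 - t)" using x t by simp
      with tendsto_const_mult_square_at_0[of "perturbation_constant z \<gamma> x"]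
      have "eventually (\<lambda>\<alpha>. perturbation_constant z \<gamma> x * \<alpha>\<^sup>2 < (x - \<beta>' t) / (1 - t)) (at 0)"
        by (rule order_tendstoD)
      then show "eventually (\<lambda>\<alpha>. \<beta> \<alpha> t < a) (at 0)"
        using eventually_abs_le_1_at_0
      proof eventually_elim
        case (elim \<alpha>)
        \<comment> \<open>The stopping set includes its boundary, so \<open>\<beta>' t\<close>
          itself serves as the stopping point \<open>y\<close>.\<close>
        have "V' t (\<beta>' t) = \<beta>' t" using \<beta>'[OF t] by simp
        then have "V \<alpha> t x = x"
          using elim t x by (simp add: V V' value_function_eq_above_stopping_point[where y = "\<beta>' t"])
        then show ?case using \<beta>[of \<alpha> t x] elim t x by auto
      qed
    qed
  qed
qed

end
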